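(* There are two $\leq$-incomparable ceers $E_1,E_2$, with $E_1$ dark and $E_2$ light, which have a least upper bound $R$ (in the degrees of ceers) such that $R<E_1\oplus E_2$.
   Context: A ceer is a computably enumerable equivalence relation on $\omega$. For equivalence relations $E,R$ on $\omega$, $E\leq R$ means there is a computable $f$ with $x\mathrel{E}y\iff f(x)\mathrel{R}f(y)$ for all $x,y$; $X<Y$ means $X\leq Y$ and $Y\not\leq X$; least upper bounds are taken in the poset of degrees (mutual-reducibility classes) of ceers. The uniform join $E\oplus R$ is defined by $2u\mathrel{(E\oplus R)}2v\iff u\mathrel{E}v$, $2u+1\mathrel{(E\oplus R)}2v+1\iff u\mathrel{R}v$, and no even number equivalent to an odd one. $\mathrm{Id}$ is equality on $\omega$. A ceer $R$ is dark if it has infinitely many classes and $\mathrm{Id}\not\leq R$; light if $\mathrm{Id}\leq R$. *)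

theory Defs
  imports "HOL-Algebra.Order"
begin

text \<open>Codes for the partial recursive functions and their big-step evaluation. Codes carry no
  arity: a code denotes a partial function on argument lists of every length, undefined where no
  rule applies.\<close>

datatype recf =
    Zero
  | Succ
  | Proj nat
  | Comp recf "recf list"
  | PrimRec recf recf
  | Mu recf

inductive computes :: "recf \<Rightarrow> nat list \<Rightarrow> nat \<Rightarrow> bool" where
  Zero: "computes Zero xs 0"
| Succ: "computes Succ [x] (Suc x)"
| Proj: "i < length xs \<Longrightarrow> computes (Proj i) xs (xs ! i)"
| Comp: "list_all2 (\<lambda>g y. computes g xs y) gs ys \<Longrightarrow> computes f ys z \<Longrightarrow>
    computes (Comp f gs) xs z"
| PrimRec_0: "computes f xs y \<Longrightarrow> computes (PrimRec f g) (0 # xs) y"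
| PrimRec_Suc: "computes (PrimRec f g) (n # xs) r \<Longrightarrow> computes g (n # r # xs) y \<Longrightarrow>
    computes (PrimRec f g) (Suc n # xs) y"
| Mu: "computes f (n # xs) 0 \<Longrightarrow> (\<And>m. m < n \<Longrightarrow> \<exists>k>0. computes f (m # xs) k) \<Longrightarrow>
    computes (Mu f) xs n"

definition computable :: "(nat \<Rightarrow> nat) \<Rightarrow> bool" where
  "computable f \<longleftrightarrow> (\<exists>p. \<forall>x. computes p [x] (f x))"

text \<open>Computably enumerable means being the domain of a partial recursive function.\<close>

definition ce_rel :: "nat rel \<Rightarrow> bool" where
  "ce_rel E \<longleftrightarrow> (\<exists>p. \<forall>x y. (x, y) \<in> E \<longleftrightarrow> (\<exists>z. computes p [x, y] z))"

definition ceer :: "nat rel \<Rightarrow> bool" where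
  "ceer E \<longleftrightarrow> equiv UNIV E \<and> ce_rel E"

definition reducible :: "nat rel \<Rightarrow> nat rel \<Rightarrow> bool" (infix "\<le>\<^sub>c" 50) where
  "E \<le>\<^sub>c R \<longleftrightarrow> (\<exists>f. computable f \<and> (\<forall>x y. (x, y) \<in> E \<longleftrightarrow> (f x, f y) \<in> R))"

definition strictly_reducible :: "nat rel \<Rightarrow> nat rel \<Rightarrow> bool" (infix "<\<^sub>c" 50) where
  "E <\<^sub>c R \<longleftrightarrow> E \<le>\<^sub>c R \<and> \<not> R \<le>\<^sub>c E"

definition uniform_join :: "nat rel \<Rightarrow> nat rel \<Rightarrow> nat rel" (infixl "\<oplus>\<^sub>c" 65) where
  "E \<oplus>\<^sub>c R = {(2 * u, 2 * v) | u v. (u, v) \<in> E} \<union> {(2 * u + 1, 2 * v + 1) | u v. (u, v) \<in> R}"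

definition dark :: "nat rel \<Rightarrow> bool" where
  "dark R \<longleftrightarrow> ceer R \<and> infinite (UNIV // R) \<and> \<not> Id \<le>\<^sub>c R"

definition light :: "nat rel \<Rightarrow> bool" where
  "light R \<longleftrightarrow> ceer R \<and> Id \<le>\<^sub>c R"

definition mutually_reducible :: "nat rel rel" where
  "mutually_reducible = {(E, R). ceer E \<and> ceer R \<and> E \<le>\<^sub>c R \<and> R \<le>\<^sub>c E}"

definition ceer_degree :: "nat rel \<Rightarrow> nat rel set" where
  "ceer_degree E = mutually_reducible `` {E}"

definition ceer_degrees :: "nat rel set gorder" where
  "ceer_degrees =
    \<lparr>carrier = Collect ceer // mutually_reducible, eq = (=),
     le = (\<lambda>a b. \<exists>E\<in>a. \<exists>R\<in>b. E \<le>\<^sub>c R)\<rparr>"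

definition degree_lub :: "nat rel \<Rightarrow> nat rel \<Rightarrow> nat rel \<Rightarrow> bool" where
  "degree_lub R E1 E2 \<longleftrightarrow>
    least ceer_degrees (ceer_degree R) (Upper ceer_degrees {ceer_degree E1, ceer_degree E2})"

lemma reducible_refl: "E \<le>\<^sub>c E"
proof -
  have "computes (Proj 0) [x] x" for x
    using computes.Proj[of 0 "[x]"] by simp
  then have "computable (\<lambda>x. x)" unfolding computable_def by blast
  then show ?thesis unfolding reducible_def by blast
qed

lemma reducible_trans: "A \<le>\<^sub>c B \<Longrightarrow> B \<le>\<^sub>c C \<Longrightarrow> A \<le>\<^sub>c C"
proof -
  assume "A \<le>\<^sub>c B" "B \<le>\<^sub>c C"
  then obtain f g p q where
    f: "\<And>x. computes p [x] (f x)" "\<And>x y. (x, y) \<in> A \<longleftrightarrow> (f x, f y) \<in> B" and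
    g: "\<And>x. computes q [x] (g x)" "\<And>x y. (x, y) \<in> B \<longleftrightarrow> (g x, g y) \<in> C"
    unfolding reducible_def computable_def by metis
  have "computes (Comp q [p]) [x] (g (f x))" for x
    using f(1) g(1) by (auto intro!: computes.Comp[of _ _ "[f x]"])
  then have "computable (\<lambda>x. g (f x))" unfolding computable_def by blast
  then show "A \<le>\<^sub>c C" unfolding reducible_def using f(2) g(2) by blast
qed

lemma equiv_mutually_reducible: "equiv (Collect ceer) mutually_reducible"
  unfolding mutually_reducible_def
  by (intro equivI refl_onI symI transI) (auto intro: reducible_refl reducible_trans)

lemma degree_in_carrier: "ceer E \<Longrightarrow> ceer_degree E \<in> carrier ceer_degrees"
  by (simp add: ceer_degree_def ceer_degrees_def quotientI)

lemma degree_le_iff: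
  assumes "ceer E" "ceer R"
  shows "ceer_degree E \<sqsubseteq>\<^bsub>ceer_degrees\<^esub> ceer_degree R \<longleftrightarrow> E \<le>\<^sub>c R"
  using assms unfolding ceer_degree_def ceer_degrees_def mutually_reducible_def
  by (auto intro: reducible_refl reducible_trans)

lemma partial_order_ceer_degrees: "partial_order ceer_degrees"
proof -
  have car: "\<exists>E. ceer E \<and> a = ceer_degree E" if "a \<in> carrier ceer_degrees" for a
    using that by (auto simp: ceer_degrees_def ceer_degree_def elim!: quotientE)
  have eq: "eq ceer_degrees = (=)" by (simp add: ceer_degrees_def)
  have deg_eq: "ceer_degree E = ceer_degree R" if "ceer E" "ceer R" "E \<le>\<^sub>c R" "R \<le>\<^sub>c E" for E R
    unfolding ceer_degree_def
    by (rule equiv_class_eq[OF equiv_mutually_reducible])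
      (use that in \<open>simp add: mutually_reducible_def\<close>)
  show ?thesis
  proof
    fix x y assume "x \<in> carrier ceer_degrees" "y \<in> carrier ceer_degrees"
      "x \<sqsubseteq>\<^bsub>ceer_degrees\<^esub> y" "y \<sqsubseteq>\<^bsub>ceer_degrees\<^esub> x"
    then show "x .=\<^bsub>ceer_degrees\<^esub> y"
      using car deg_eq by (metis degree_le_iff eq)
  next
    fix x y z assume "x \<in> carrier ceer_degrees" "y \<in> carrier ceer_degrees"
      "z \<in> carrier ceer_degrees" "x \<sqsubseteq>\<^bsub>ceer_degrees\<^esub> y" "y \<sqsubseteq>\<^bsub>ceer_degrees\<^esub> z"
    then show "x \<sqsubseteq>\<^bsub>ceer_degrees\<^esub> z"
      using car by (metis degree_le_iff reducible_trans)
  next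
    fix x assume "x \<in> carrier ceer_degrees"
    then show "x \<sqsubseteq>\<^bsub>ceer_degrees\<^esub> x"
      using car by (metis degree_le_iff reducible_refl)
  qed (simp_all add: eq)
qed

lemma degree_lub_iff:
  assumes "ceer R" "ceer E1" "ceer E2"
  shows "degree_lub R E1 E2 \<longleftrightarrow>
    E1 \<le>\<^sub>c R \<and> E2 \<le>\<^sub>c R \<and> (\<forall>S. ceer S \<longrightarrow> E1 \<le>\<^sub>c S \<longrightarrow> E2 \<le>\<^sub>c S \<longrightarrow> R \<le>\<^sub>c S)"
proof -
  have car: "carrier ceer_degrees = ceer_degree ` Collect ceer"
    by (auto simp: ceer_degrees_def ceer_degree_def quotient_def)
  have U: "Upper ceer_degrees {ceer_degree E1, ceer_degree E2} =
      ceer_degree ` {S. ceer S \<and> E1 \<le>\<^sub>c S \<and> E2 \<le>\<^sub>c S}"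
    using assms degree_in_carrier unfolding Upper_def
    by (auto simp: car degree_le_iff)
  have mem: "ceer_degree R \<in> Upper ceer_degrees {ceer_degree E1, ceer_degree E2} \<longleftrightarrow> E1 \<le>\<^sub>c R \<and> E2 \<le>\<^sub>c R"
    using assms degree_in_carrier unfolding Upper_def by (auto simp: degree_le_iff)
  have "degree_lub R E1 E2 \<longleftrightarrow> ceer_degree R \<in> Upper ceer_degrees {ceer_degree E1, ceer_degree E2} \<and>
      (\<forall>x\<in>Upper ceer_degrees {ceer_degree E1, ceer_degree E2}. ceer_degree R \<sqsubseteq>\<^bsub>ceer_degrees\<^esub> x)"
    unfolding degree_lub_def least_def using Upper_closed by blast
  also have "\<dots> \<longleftrightarrow> (E1 \<le>\<^sub>c R \<and> E2 \<le>\<^sub>c R) \<and>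
      (\<forall>S. ceer S \<longrightarrow> E1 \<le>\<^sub>c S \<longrightarrow> E2 \<le>\<^sub>c S \<longrightarrow> R \<le>\<^sub>c S)"
    unfolding mem unfolding U using assms(1) by (auto simp: degree_le_iff)
  finally show ?thesis by simp
qed

end

theory Submission imports Defs "HOL-Library.Nat_Bijection" begin

text \<open>Let \<open>E\<close> be a dark ceer. A self-reduction of a dark ceer is onto its classes, as the iterates of a
  missed point would embed \<open>Id\<close>. Hence for dark \<open>D\<close> and \<open>C\<close> there is no reduction of \<open>D \<oplus> C\<close> to \<open>D \<oplus> Id\<close>:
  it sends only finitely many classes of \<open>D\<close> to \<open>Id\<close>, and those can be rerouted to classes used by \<open>C\<close>.
  On the other hand, \<open>D \<oplus> Id\<close> is the least upper bound of \<open>D\<close> and \<open>Id\<close>, because the images of \<open>D\<close> and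
  \<open>Id\<close> in a common upper bound meet in finitely many classes only.
  Therefore \<open>E1 = E \<oplus> E\<close> and \<open>E2 = E \<oplus> Id\<close> are incomparable with least upper bound \<open>R = E \<oplus> E \<oplus> Id\<close>, and
  \<open>E1 \<oplus> E2 \<le> R\<close> would reduce \<open>(E \<oplus> E) \<oplus> E\<close> to \<open>(E \<oplus> E) \<oplus> Id\<close>.
  For \<open>E\<close> one takes equality with the elements of a simple set collapsed; a universal machine is
  needed to construct the simple set, and to enumerate an arbitrary ceer in stages.\<close>

section \<open>A calculus of total recursive functions\<close>

text \<open>Codes have no arity. Fixing the length \<open>n\<close> makes a function on lists stand
  for an \<open>n\<close>-ary function; its values on lists of other lengths are left open.\<close>

definition recursive :: "nat \<Rightarrow> (nat list \<Rightarrow> nat) \<Rightarrow> bool" where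
  "recursive n f \<longleftrightarrow> (\<exists>p. \<forall>xs. length xs = n \<longrightarrow> computes p xs (f xs))"

lemma recursiveI: "(\<And>xs. length xs = n \<Longrightarrow> computes p xs (f xs)) \<Longrightarrow> recursive n f"
  unfolding recursive_def by blast

lemma recursive_cong:
  "(\<And>xs. length xs = n \<Longrightarrow> f xs = g xs) \<Longrightarrow> recursive n f \<longleftrightarrow> recursive n g"
  unfolding recursive_def by auto

lemma recursive_comp:
  assumes f: "recursive (length gs) f" and gs: "\<And>g. g \<in> set gs \<Longrightarrow> recursive n g"
  shows "recursive n (\<lambda>xs. f (map (\<lambda>g. g xs) gs))"
proof -
  obtain p where p: "\<And>xs. length xs = length gs \<Longrightarrow> computes p xs (f xs)"
    using f unfolding recursive_def by blast
  obtain c where c: "\<And>g xs. g \<in> set gs \<Longrightarrow> length xs = n \<Longrightarrow> computes (c g) xs (g xs)"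
    using gs unfolding recursive_def by metis
  show ?thesis
  proof (rule recursiveI[where p = "Comp p (map c gs)"])
    fix xs :: "nat list" assume "length xs = n"
    then show "computes (Comp p (map c gs)) xs (f (map (\<lambda>g. g xs) gs))"
      by (intro computes.Comp[of _ _ "map (\<lambda>g. g xs) gs"])
        (auto simp: list_all2_conv_all_nth c p)
  qed
qed

lemma recursive_nth: "i < n \<Longrightarrow> recursive n (\<lambda>xs. xs ! i)"
  by (rule recursiveI[where p = "Proj i"]) (auto intro: computes.Proj)

lemma recursive_hd: "0 < n \<Longrightarrow> recursive n hd"
  using recursive_nth[of 0 n] by (subst recursive_cong[of _ _ "\<lambda>xs. xs ! 0"]) (auto simp: hd_conv_nth)

text \<open>\<open>tl ys\<close> is the list of the projections from the second on. This carries
  parameters under a binder that puts one more argument in front, as recursion and search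
  do.\<close>

lemma recursive_shift:
  assumes "recursive n f"
  shows "recursive (Suc n) (\<lambda>ys. f (tl ys))"
proof -
  have "recursive (Suc n) (\<lambda>xs. f (map (\<lambda>g. g xs) (map (\<lambda>i xs. xs ! Suc i) [0..<n])))"
    by (rule recursive_comp) (use assms in \<open>auto intro: recursive_nth\<close>)
  then show ?thesis
    by (subst recursive_cong[of _ _ "\<lambda>xs. f (map (\<lambda>g. g xs) (map (\<lambda>i xs. xs ! Suc i) [0..<n]))"])
      (auto simp: comp_def nth_tl intro!: arg_cong[of _ _ f] nth_equalityI)
qed

lemma recursive_shift2: "recursive n f \<Longrightarrow> recursive (Suc (Suc n)) (\<lambda>ys. f (tl (tl ys)))"
  using recursive_shift[OF recursive_shift, of n f] .

lemma recursive_tl_nth: "Suc i < n \<Longrightarrow> recursive n (\<lambda>xs. tl xs ! i)"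
  using recursive_shift[OF recursive_nth, of i "n - 1"] by (cases n) auto

lemma recursive_tl_tl_nth: "Suc (Suc i) < n \<Longrightarrow> recursive n (\<lambda>xs. tl (tl xs) ! i)"
  using recursive_shift[OF recursive_tl_nth, of i "n - 1"] by (cases n) auto

lemma recursive_hd_tl: "Suc 0 < n \<Longrightarrow> recursive n (\<lambda>xs. hd (tl xs))"
  using recursive_shift[OF recursive_hd, of "n - 1"] by (cases n) auto

lemma computable_iff_recursive: "computable f \<longleftrightarrow> recursive 1 (\<lambda>xs. f (xs ! 0))"
proof
  assume "computable f"
  then obtain p where "\<And>x. computes p [x] (f x)" unfolding computable_def by blast
  then show "recursive 1 (\<lambda>xs. f (xs ! 0))"
    by (intro recursiveI[where p = p]) (auto simp: length_Suc_conv)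
next
  assume "recursive 1 (\<lambda>xs. f (xs ! 0))"
  then obtain p where "\<And>xs. length xs = 1 \<Longrightarrow> computes p xs (f (xs ! 0))"
    unfolding recursive_def by blast
  from this[of "[_]"] show "computable f" unfolding computable_def by auto
qed

lemma recursive_app:
  "computable f \<Longrightarrow> recursive n a \<Longrightarrow> recursive n (\<lambda>xs. f (a xs))"
  using recursive_comp[of "[a]" "\<lambda>xs. f (xs ! 0)" n] by (simp add: computable_iff_recursive)

lemma computable_Suc: "computable Suc"
  unfolding computable_def using computes.Succ by blast

lemmas recursive_Suc = recursive_app[OF computable_Suc]

lemma recursive_const: "recursive n (\<lambda>_. c)"
proof (induction c)
  case 0
  then show ?case by (rule recursiveI[where p = Zero]) (rule computes.Zero)
next
  case (Suc c)
  then show ?case by (rule recursive_Suc)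
qed

lemma recursive_rec_nat:
  assumes b: "recursive n b" and a: "recursive n a"
    and g: "recursive (Suc (Suc n)) (\<lambda>ys. g (hd ys) (hd (tl ys)) (tl (tl ys)))"
  shows "recursive n (\<lambda>xs. rec_nat (a xs) (\<lambda>k r. g k r xs) (b xs))"
proof -
  obtain pa where pa: "\<And>xs. length xs = n \<Longrightarrow> computes pa xs (a xs)"
    using a unfolding recursive_def by blast
  obtain pg where "\<And>ys. length ys = Suc (Suc n) \<Longrightarrow>
      computes pg ys (g (hd ys) (hd (tl ys)) (tl (tl ys)))"
    using g unfolding recursive_def by blast
  from this[of "_ # _ # _"] have pg: "computes pg (k # r # xs) (g k r xs)" if "length xs = n" for k r xs
    using that by simp
  have "computes (PrimRec pa pg) (k # xs) (rec_nat (a xs) (\<lambda>k r. g k r xs) k)"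
    if "length xs = n" for k xs
    by (induction k) (auto intro: computes.intros pa pg that)
  then have "recursive (Suc n) (\<lambda>ys. rec_nat (a (tl ys)) (\<lambda>k r. g k r (tl ys)) (hd ys))"
    by (intro recursiveI[where p = "PrimRec pa pg"]) (auto simp: length_Suc_conv)
  \<comment> \<open>\<open>PrimRec\<close> recurses on its first argument. Composing with
    \<open>b\<close> followed by all projections makes \<open>b xs\<close> the recursion depth and
    passes \<open>xs\<close> on unchanged.\<close>
  then have "recursive n (\<lambda>xs. (\<lambda>ys. rec_nat (a (tl ys)) (\<lambda>k r. g k r (tl ys)) (hd ys))
      (map (\<lambda>g. g xs) (b # map (\<lambda>i xs. xs ! i) [0..<n])))"
    by (intro recursive_comp) (use b in \<open>auto intro: recursive_nth\<close>)
  moreover have "map (\<lambda>i. xs ! i) [0..<n] = xs" if "length xs = n" for xs :: "nat list"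
    using that map_nth by blast
  ultimately show ?thesis
    by (subst (asm) recursive_cong[of _ _ "\<lambda>xs. rec_nat (a xs) (\<lambda>k r. g k r xs) (b xs)"])
      (auto simp: comp_def)
qed

lemma recursive_funpow:
  assumes f: "computable f" and a: "recursive n a" and b: "recursive n b"
  shows "recursive n (\<lambda>xs. (f ^^ a xs) (b xs))"
proof -
  have "(f ^^ k) x = rec_nat x (\<lambda>_ r. f r) k" for k x by (induction k) auto
  then show ?thesis
    using recursive_rec_nat[OF a b, of "\<lambda>_ r _. f r"] recursive_app[OF f] by (simp add: recursive_hd_tl)
qed

lemma recursive_add:
  assumes "recursive n a" "recursive n b" shows "recursive n (\<lambda>xs. a xs + b xs)"
proof -
  have "(Suc ^^ k) x = k + x" for k x by (induction k) auto
  then show ?thesis using recursive_funpow[OF computable_Suc assms] by simp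
qed

lemma computable_pred: "computable (\<lambda>x. x - 1)"
proof -
  have "rec_nat 0 (\<lambda>k _. k) x = x - 1" for x by (cases x) auto
  then show ?thesis
    using recursive_rec_nat[of 1 "\<lambda>xs. xs ! 0" "\<lambda>_. 0" "\<lambda>k _ _. k"]
    by (simp add: computable_iff_recursive recursive_const recursive_nth recursive_hd)
qed

lemma recursive_diff:
  assumes "recursive n a" "recursive n b" shows "recursive n (\<lambda>xs. a xs - b xs)"
proof -
  have "((\<lambda>x. x - 1) ^^ k) x = x - k" for k x :: nat by (induction k) auto
  then show ?thesis using recursive_funpow[OF computable_pred assms(2,1)] by simp
qed

lemma recursive_mult:
  assumes "recursive n a" "recursive n b" shows "recursive n (\<lambda>xs. a xs * b xs)"
proof -
  have "rec_nat 0 (\<lambda>_ r. r + x) k = k * x" for k x :: nat by (induction k) auto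
  then show ?thesis
    using recursive_rec_nat[OF assms(1) recursive_const[of n 0], of "\<lambda>_ r xs. r + b xs"] assms(2)
    by (simp add: recursive_add recursive_shift2 recursive_hd_tl)
qed

lemma recursive_power:
  assumes "recursive n a" shows "recursive n (\<lambda>xs. c ^ a xs)"
proof -
  have "rec_nat 1 (\<lambda>_ r. r * c) k = c ^ k" for k by (induction k) auto
  then show ?thesis
    using recursive_rec_nat[OF assms recursive_const[of n 1], of "\<lambda>_ r _. r * c"]
    by (simp add: recursive_mult recursive_hd_tl recursive_const)
qed

section \<open>Decidable predicates, case distinction and search\<close>

definition decidable :: "nat \<Rightarrow> (nat list \<Rightarrow> bool) \<Rightarrow> bool" where
  "decidable n P \<longleftrightarrow> recursive n (\<lambda>xs. of_bool (P xs))"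

text \<open>A case distinction is a recursion of depth 0 or 1 whose step ignores the previous
  value.\<close>

lemma recursive_if:
  assumes "decidable n P" "recursive n a" "recursive n b"
  shows "recursive n (\<lambda>xs. if P xs then a xs else b xs)"
proof -
  have "rec_nat y (\<lambda>_ _. x) (of_bool Q) = (if Q then x else y)" for x y :: nat and Q by auto
  then show ?thesis
    using recursive_rec_nat[OF assms(1)[unfolded decidable_def] assms(3), of "\<lambda>_ _. a"] assms(2)
    by (simp add: recursive_shift2)
qed

lemma decidable_le:
  assumes "recursive n a" "recursive n b" shows "decidable n (\<lambda>xs. a xs \<le> b xs)"
proof -
  have "of_bool (x \<le> y) = 1 - (x - y)" for x y :: nat by auto
  then show ?thesis
    unfolding decidable_def using assms by (simp only: recursive_diff recursive_const)
qed

lemma decidable_not: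
  assumes "decidable n P" shows "decidable n (\<lambda>xs. \<not> P xs)"
proof -
  have "of_bool (\<not> Q) = 1 - (of_bool Q :: nat)" for Q by simp
  then show ?thesis
    using assms unfolding decidable_def by (simp only: recursive_diff recursive_const)
qed

lemma decidable_conj: "decidable n P \<Longrightarrow> decidable n Q \<Longrightarrow> decidable n (\<lambda>xs. P xs \<and> Q xs)"
  unfolding decidable_def of_bool_conj by (rule recursive_mult)

lemma decidable_disj: "decidable n P \<Longrightarrow> decidable n Q \<Longrightarrow> decidable n (\<lambda>xs. P xs \<or> Q xs)"
  using decidable_not[OF decidable_conj[OF decidable_not decidable_not]] by simp

lemma decidable_less:
  assumes "recursive n a" "recursive n b" shows "decidable n (\<lambda>xs. a xs < b xs)"
  using decidable_not[OF decidable_le[OF assms(2,1)]] by (simp add: not_le)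

lemma decidable_eq:
  assumes "recursive n a" "recursive n b" shows "decidable n (\<lambda>xs. a xs = b xs)"
  using decidable_conj[OF decidable_le[OF assms] decidable_le[OF assms(2,1)]]
  by (simp add: order.eq_iff)

lemma recursive_Least:
  assumes P: "decidable (Suc n) (\<lambda>ys. P (hd ys) (tl ys))"
    and ex: "\<And>xs. length xs = n \<Longrightarrow> \<exists>m. P m xs"
  shows "recursive n (\<lambda>xs. LEAST m. P m xs)"
proof -
  \<comment> \<open>\<open>Mu\<close> stops at the first zero, so the search is for a zero of the
    characteristic function of the negation.\<close>
  obtain p where "\<And>ys. length ys = Suc n \<Longrightarrow> computes p ys (of_bool (\<not> P (hd ys) (tl ys)))"
    using decidable_not[OF P] unfolding decidable_def recursive_def by blast
  from this[of "_ # _"] have p: "computes p (m # xs) (of_bool (\<not> P m xs))" if "length xs = n" for m xs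
    using that by simp
  show ?thesis
  proof (rule recursiveI[where p = "Mu p"], rule computes.Mu)
    fix xs :: "nat list" assume n: "length xs = n"
    let ?l = "LEAST m. P m xs"
    from ex[OF n] have "P ?l xs" by (metis LeastI)
    then show "computes p (?l # xs) 0" using p[OF n, of ?l] by simp
    fix m assume "m < ?l"
    then have "\<not> P m xs" by (rule not_less_Least)
    then show "\<exists>k>0. computes p (m # xs) k" using p[OF n, of m] by auto
  qed
qed

lemma computable_mod_2: "computable (\<lambda>x. x mod 2)"
proof -
  have "rec_nat 0 (\<lambda>_ r. 1 - r) x = x mod 2" for x :: nat
    by (induction x) (simp_all, presburger)
  then show ?thesis
    using recursive_rec_nat[of 1 "\<lambda>xs. xs ! 0" "\<lambda>_. 0" "\<lambda>_ r _. 1 - r"]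
    by (simp add: computable_iff_recursive recursive_const recursive_nth recursive_hd_tl
        recursive_diff del: One_nat_def)
qed

lemma computable_div_2: "computable (\<lambda>x. x div 2)"
proof -
  have "rec_nat 0 (\<lambda>k r. r + k mod 2) x = x div 2" for x :: nat
    by (induction x) (simp_all, presburger)
  then show ?thesis
    using recursive_rec_nat[of 1 "\<lambda>xs. xs ! 0" "\<lambda>_. 0" "\<lambda>k r _. r + k mod 2"]
    by (simp add: computable_iff_recursive recursive_const recursive_nth recursive_hd_tl recursive_hd
        recursive_add recursive_app[OF computable_mod_2])
qed

lemmas recursive_div_2 = recursive_app[OF computable_div_2]

lemma decidable_even: "recursive n a \<Longrightarrow> decidable n (\<lambda>xs. even (a xs))"
  using decidable_eq[OF recursive_app[OF computable_mod_2] recursive_const[of n 0]]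
  by (simp add: even_iff_mod_2_eq_zero)

lemmas recursive_intros = recursive_const recursive_nth recursive_tl_nth recursive_tl_tl_nth
  recursive_hd recursive_hd_tl recursive_Suc recursive_add recursive_diff recursive_mult
  recursive_div_2 recursive_power recursive_if decidable_le decidable_less decidable_eq
  decidable_not decidable_conj decidable_disj decidable_even

section \<open>Computability of the Cantor pairing and its projections\<close>

lemma recursive_prod_encode:
  "recursive n a \<Longrightarrow> recursive n b \<Longrightarrow> recursive n (\<lambda>xs. prod_encode (a xs, b xs))"
  unfolding prod_encode_def triangle_def prod.case by (intro recursive_intros)

definition pfst :: "nat \<Rightarrow> nat" where "pfst z = fst (prod_decode z)"
definition psnd :: "nat \<Rightarrow> nat" where "psnd z = snd (prod_decode z)"

lemma pfst_encode [simp]: "pfst (prod_encode (x, y)) = x"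
  and psnd_encode [simp]: "psnd (prod_encode (x, y)) = y"
  by (simp_all add: pfst_def psnd_def)

lemma prod_encode_pfst_psnd [simp]: "prod_encode (pfst z, psnd z) = z"
  by (simp add: pfst_def psnd_def)

lemma triangle_mono: "m \<le> n \<Longrightarrow> triangle m \<le> triangle n"
  unfolding triangle_def by (intro div_le_mono mult_le_mono) auto

text \<open>The code of \<open>(a, b)\<close> is \<open>triangle (a + b) + a\<close>, which lies
  below the next triangular number. Hence a search recovers the sum of the components, from which
  both of them follow by subtraction.\<close>

lemma triangle_root:
  "(LEAST k. z < triangle (Suc k)) = pfst z + psnd z"
proof -
  have z: "z = triangle (pfst z + psnd z) + pfst z"
    using prod_encode_pfst_psnd[of z] unfolding prod_encode_def by simp
  show ?thesis
  proof (rule Least_equality)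
    show "z < triangle (Suc (pfst z + psnd z))" using z by simp
    fix k assume "z < triangle (Suc k)"
    then show "pfst z + psnd z \<le> k"
      using z triangle_mono[of "Suc k" "pfst z + psnd z"] by linarith
  qed
qed

lemma computable_pfst: "computable pfst"
  and computable_psnd: "computable psnd"
proof -
  have ex: "\<exists>m. z < triangle (Suc m)" for z
    by (rule exI[of _ z]) (simp add: less_Suc_eq_le)
  have "recursive 1 (\<lambda>xs. LEAST k. xs ! 0 < triangle (Suc k))"
    unfolding triangle_def
    by (rule recursive_Least[where P = "\<lambda>k xs. xs ! 0 < Suc k * Suc (Suc k) div 2"])
      (use ex in \<open>auto intro!: recursive_intros simp: triangle_def\<close>)
  then have r: "recursive 1 (\<lambda>xs. pfst (xs ! 0) + psnd (xs ! 0))"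
    by (simp only: triangle_root)
  have z: "z = triangle (pfst z + psnd z) + pfst z" for z
    using prod_encode_pfst_psnd[of z] unfolding prod_encode_def by simp
  have "pfst z = z - triangle (pfst z + psnd z)" for z
    using z[of z] by simp
  moreover have "recursive 1 (\<lambda>xs. xs ! 0 - triangle (pfst (xs ! 0) + psnd (xs ! 0)))"
    unfolding triangle_def by (intro recursive_intros r) simp
  ultimately show f: "computable pfst"
    unfolding computable_iff_recursive by simp
  then have "recursive 1 (\<lambda>xs. (pfst (xs ! 0) + psnd (xs ! 0)) - pfst (xs ! 0))"
    by (intro recursive_intros r recursive_app[OF f]) simp
  then show "computable psnd" by (simp add: computable_iff_recursive)
qed

lemmas recursive_pfst = recursive_app[OF computable_pfst]
lemmas recursive_psnd = recursive_app[OF computable_psnd]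

lemmas recursive_pair_intros = recursive_intros recursive_prod_encode recursive_pfst recursive_psnd

section \<open>An abstract machine for recursive functions\<close>

text \<open>A frame is work suspended until a value returns: \<open>CompF\<close> holds the outer
  function, the arguments still to be evaluated, the input and the values found so far;
  \<open>RecF\<close> holds a pending recursion step; \<open>MuF\<close> holds the index whose test
  is running.\<close>

datatype frame =
    CompF recf "recf list" "nat list" "nat list"
  | RecF recf nat "nat list"
  | MuF recf nat "nat list"

datatype state =
    Eval recf "nat list" "frame list"
  | Args recf "recf list" "nat list" "nat list" "frame list"
  | Ret nat "frame list"

text \<open>Arguments are evaluated from right to left, so that their values accumulate in the right order.\<close>

fun step :: "state \<Rightarrow> state" where
  "step (Eval Zero xs K) = Ret 0 K"
| "step (Eval Succ xs K) = (case xs of [x] \<Rightarrow> Ret (Suc x) K | _ \<Rightarrow> Eval Succ xs K)"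
| "step (Eval (Proj i) xs K) =
    (case xs of [] \<Rightarrow> Eval (Proj i) xs K
      | x # xs' \<Rightarrow> (case i of 0 \<Rightarrow> Ret x K | Suc j \<Rightarrow> Eval (Proj j) xs' K))"
| "step (Eval (Comp f gs) xs K) = Args f (rev gs) xs [] K"
| "step (Eval (PrimRec f g) xs K) =
    (case xs of [] \<Rightarrow> Eval (PrimRec f g) xs K
      | x # xs' \<Rightarrow> (case x of 0 \<Rightarrow> Eval f xs' K
          | Suc n \<Rightarrow> Eval (PrimRec f g) (n # xs') (RecF g n xs' # K)))"
| "step (Eval (Mu f) xs K) = Eval f (0 # xs) (MuF f 0 xs # K)"
| "step (Args f gs xs ys K) =
    (case gs of [] \<Rightarrow> Eval f ys K | g # gs' \<Rightarrow> Eval g xs (CompF f gs' xs ys # K))"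
| "step (Ret v []) = Ret v []"
| "step (Ret v (CompF f gs xs ys # K)) = Args f gs xs (v # ys) K"
| "step (Ret v (RecF g n xs # K)) = Eval g (n # v # xs) K"
| "step (Ret v (MuF f m xs # K)) =
    (if v = 0 then Ret m K else Eval f (Suc m # xs) (MuF f (Suc m) xs # K))"

definition reach :: "state \<Rightarrow> state \<Rightarrow> bool" where
  "reach a b \<longleftrightarrow> (\<exists>s. (step ^^ s) a = b)"

lemma reach_refl: "reach a a"
  unfolding reach_def by (rule exI[of _ 0]) simp

lemma reach_step: "reach (step a) b \<Longrightarrow> reach a b"
  unfolding reach_def by (metis comp_apply funpow_Suc_right)

lemma reach_trans: "reach a b \<Longrightarrow> reach b c \<Longrightarrow> reach a c"
  unfolding reach_def by (metis comp_apply funpow_add)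

text \<open>Evaluating the reversed list and pushing each value in front restores the order of
  \<open>gs\<close>. The remaining functions \<open>hs\<close> and the earlier values
  \<open>zs\<close> are arbitrary so that the induction goes through.\<close>

lemma reach_args:
  assumes "list_all2 (\<lambda>g y. \<forall>K. reach (Eval g xs K) (Ret y K)) gs ys"
  shows "reach (Args f (rev gs @ hs) xs zs K) (Args f hs xs (ys @ zs) K)"
  using assms
proof (induction gs ys arbitrary: hs rule: list_all2_induct)
  case Nil
  then show ?case by (simp add: reach_refl)
next
  case (Cons g gs y ys)
  have "reach (Args f (rev gs @ g # hs) xs zs K) (Args f (g # hs) xs (ys @ zs) K)"
    by (rule Cons.IH)
  moreover have "reach (Args f (g # hs) xs (ys @ zs) K) (Ret y (CompF f hs xs (ys @ zs) # K))"
    using Cons.hyps(1) by (intro reach_step[of "Args _ _ _ _ _"]) auto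
  moreover have "reach (Ret y (CompF f hs xs (ys @ zs) # K)) (Args f hs xs (y # ys @ zs) K)"
    by (rule reach_step) (simp add: reach_refl)
  ultimately show ?case by (auto intro: reach_trans)
qed

text \<open>Induction over the derivation, for every stack \<open>K\<close>, since a subcomputation
  runs on top of the frames of its caller.\<close>

lemma computes_reach: "computes p xs y \<Longrightarrow> reach (Eval p xs K) (Ret y K)"
proof (induction arbitrary: K rule: computes.induct)
  case (Zero xs)
  then show ?case by (intro reach_step[of "Eval _ _ _"]) (simp add: reach_refl)
next
  case (Succ x)
  then show ?case by (intro reach_step[of "Eval _ _ _"]) (simp add: reach_refl)
next
  case (Proj i xs)
  then show ?case
  proof (induction xs arbitrary: i)
    case (Cons x xs)
    then show ?case
      by (intro reach_step[of "Eval _ _ _"]) (cases i; simp add: reach_refl)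
  qed simp
next
  case (Comp xs gs ys f z)
  then have "list_all2 (\<lambda>g y. \<forall>K. reach (Eval g xs K) (Ret y K)) gs ys"
    by (auto elim: list_all2_mono)
  from reach_args[OF this, of f "[]" "[]"]
  have "reach (Eval (recf.Comp f gs) xs K) (Args f [] xs ys K)"
    by (intro reach_step[of "Eval _ _ _"]) simp
  moreover have "reach (Args f [] xs ys K) (Ret z K)"
    using Comp by (intro reach_step[of "Args _ _ _ _ _"]) simp
  ultimately show ?case by (rule reach_trans)
next
  case (PrimRec_0 f xs y g)
  then show ?case by (intro reach_step[of "Eval _ _ _"]) simp
next
  case (PrimRec_Suc f g n xs r y)
  have "reach (Eval (PrimRec f g) (Suc n # xs) K) (Ret r (RecF g n xs # K))"
    using PrimRec_Suc.IH(1) by (intro reach_step[of "Eval _ _ _"]) simp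
  moreover have "reach (Ret r (RecF g n xs # K)) (Ret y K)"
    using PrimRec_Suc.IH(2) by (intro reach_step[of "Ret _ _"]) simp
  ultimately show ?case by (rule reach_trans)
next
  case (Mu f n xs)
  \<comment> \<open>Every index below \<open>n\<close> gives a positive value, so the search gets as
    far as testing each \<open>m\<close> up to \<open>n\<close>.\<close>
  have "reach (Eval f (0 # xs) (MuF f 0 xs # K)) (Eval f (m # xs) (MuF f m xs # K))" if "m \<le> n" for m
    using that
  proof (induction m)
    case (Suc m)
    obtain k where k: "k > 0" "\<And>K. reach (Eval f (m # xs) K) (Ret k K)"
      using Mu.IH(2)[of m] Suc.prems by auto
    have "reach (Ret k (MuF f m xs # K)) (Eval f (Suc m # xs) (MuF f (Suc m) xs # K))"
      using k(1) by (intro reach_step[of "Ret _ _"]) (simp add: reach_refl)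
    then show ?case using Suc k(2) by (meson Suc_leD reach_trans)
  qed (rule reach_refl)
  then have "reach (Eval f (0 # xs) (MuF f 0 xs # K)) (Ret 0 (MuF f n xs # K))"
    using Mu.IH(1) by (blast intro: reach_trans)
  moreover have "reach (Ret 0 (MuF f n xs # K)) (Ret n K)"
    by (intro reach_step[of "Ret _ _"]) (simp add: reach_refl)
  ultimately show ?case
    by (intro reach_step[of "Eval _ _ _"]) (auto intro: reach_trans)
qed

text \<open>The big-step meaning of a stack: what must be derivable in order that returning
  \<open>v\<close> to it leads to the final value \<open>w\<close>. For \<open>MuF\<close>,
  \<open>v\<close> is the value at index \<open>m\<close>; if it is positive, the search must
  succeed at a later index.\<close>

fun kont :: "frame list \<Rightarrow> nat \<Rightarrow> nat \<Rightarrow> bool" where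
  "kont [] v w \<longleftrightarrow> v = w"
| "kont (CompF f gs xs ys # K) v w \<longleftrightarrow>
    (\<exists>zs z. list_all2 (\<lambda>g y. computes g xs y) gs zs \<and> computes f (rev zs @ v # ys) z \<and> kont K z w)"
| "kont (RecF g n xs # K) v w \<longleftrightarrow> (\<exists>z. computes g (n # v # xs) z \<and> kont K z w)"
| "kont (MuF f m xs # K) v w \<longleftrightarrow>
    (if v = 0 then kont K m w
     else \<exists>n>m. computes f (n # xs) 0 \<and> (\<forall>j. m < j \<and> j < n \<longrightarrow> (\<exists>k>0. computes f (j # xs) k)) \<and> kont K n w)"

text \<open>The value that a state promises to deliver; an invariant when the machine runs backwards.\<close>

fun yields :: "state \<Rightarrow> nat \<Rightarrow> bool" where
  "yields (Eval p xs K) w \<longleftrightarrow> (\<exists>y. computes p xs y \<and> kont K y w)"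
| "yields (Args f gs xs ys K) w \<longleftrightarrow>
    (\<exists>zs z. list_all2 (\<lambda>g y. computes g xs y) gs zs \<and> computes f (rev zs @ ys) z \<and> kont K z w)"
| "yields (Ret v K) w \<longleftrightarrow> kont K v w"

text \<open>Soundness of the machine, one transition at a time: what the successor promises,
  combined with the matching rule of \<open>computes\<close>, gives the promise of the state itself.
  Stuck states are their own successors.\<close>

lemma yields_step: "yields (step a) w \<Longrightarrow> yields a w"
proof (induction a rule: step.induct)
  case (1 xs K)
  then show ?case by (auto intro: computes.intros)
next
  case (2 xs K)
  then show ?case by (auto split: list.splits) (metis computes.Succ)
next
  case (3 i xs K)
  \<comment> \<open>The machine evaluates a projection by peeling off list elements, so a projection
    of the tail has to be lifted to the whole list.\<close>
  have Suc: "computes (Proj (Suc i)) (x # xs) y" if "computes (Proj i) xs y" for i x xs y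
    using that by cases (metis Suc_less_eq length_Cons nth_Cons_Suc computes.Proj)
  have 0: "computes (Proj 0) (x # xs) x" for x xs
    using computes.Proj[of 0 "x # xs"] by simp
  show ?case
  proof (cases xs)
    case Nil
    then show ?thesis using 3 by simp
  next
    case (Cons x xs')
    then show ?thesis using 3 by (cases i) (auto intro: 0 dest: Suc)
  qed
next
  case (4 f gs xs K)
  then obtain zs z where z: "list_all2 (\<lambda>g y. computes g xs y) (rev gs) zs" "computes f (rev zs) z" "kont K z w"
    by auto
  from z(1) have "list_all2 (\<lambda>g y. computes g xs y) gs (rev zs)"
    by (simp add: list_all2_rev1)
  with z show ?case by (auto dest: computes.Comp)
next
  case (5 f g xs K)
  show ?case
  proof (cases xs)
    case (Cons x xs')
    then show ?thesis
      using 5 by (cases x) (auto intro: computes.PrimRec_0 dest: computes.PrimRec_Suc)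
  qed (use 5 in simp)
next
  case (6 f xs K)
  then obtain v where v: "computes f (0 # xs) v" "kont (MuF f 0 xs # K) v w" by auto
  show ?case
  proof (cases "v = 0")
    case True
    then show ?thesis using v by (auto intro!: exI[of _ 0] computes.Mu)
  next
    case False
    with v(2) obtain n where n: "computes f (n # xs) 0" "kont K n w"
      "\<And>j. 0 < j \<Longrightarrow> j < n \<Longrightarrow> \<exists>k>0. computes f (j # xs) k" by auto
    \<comment> \<open>Index 0 is witnessed by \<open>v\<close>, the later ones by the condition on
      the stack.\<close>
    have "\<exists>k>0. computes f (j # xs) k" if "j < n" for j
      using n(3)[of j] v(1) False that by (cases j) auto
    with n(1) have "computes (Mu f) xs n" by (rule computes.Mu)
    then show ?thesis using n(2) by auto
  qed
next
  case (7 f gs xs ys K)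
  then show ?case by (cases gs) (fastforce simp: list_all2_Cons1)+
next
  case (11 v f m xs K)
  show ?case
  proof (cases "v = 0")
    case False
    with 11 obtain u where u: "computes f (Suc m # xs) u" "kont (MuF f (Suc m) xs # K) u w"
      by auto
    show ?thesis
    proof (cases "u = 0")
      case True
      then show ?thesis using False u by (auto intro!: exI[of _ "Suc m"])
    next
      case nz: False
      with u(2) obtain n where n: "n > Suc m" "computes f (n # xs) 0" "kont K n w"
        "\<And>j. Suc m < j \<Longrightarrow> j < n \<Longrightarrow> \<exists>k>0. computes f (j # xs) k" by auto
      have "\<exists>k>0. computes f (j # xs) k" if "m < j" "j < n" for j
        using n(4)[of j] u(1) nz that by (cases "j = Suc m") auto
      moreover have "m < n" using n(1) by simp
      ultimately show ?thesis using False n(2,3) by (simp; blast)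
    qed
  qed (use 11 in simp)
qed auto

lemma reach_yields: "reach a (Ret w []) \<Longrightarrow> yields a w"
proof -
  have "(step ^^ s) a = Ret w [] \<Longrightarrow> yields a w" for s
    by (induction s arbitrary: a) (auto simp: funpow_swap1 intro: yields_step)
  then show "reach a (Ret w []) \<Longrightarrow> yields a w" unfolding reach_def by blast
qed

lemma computes_iff_reach: "computes p xs y \<longleftrightarrow> reach (Eval p xs []) (Ret y [])"
  using computes_reach reach_yields by fastforce

section \<open>The machine on codes\<close>

text \<open>The arguments of a composition are stored in reverse, the order in which the machine
  evaluates them, so the step on codes never has to reverse a list.\<close>

fun encode_recf :: "recf \<Rightarrow> nat" where
  "encode_recf Zero = prod_encode (0, 0)"
| "encode_recf Succ = prod_encode (1, 0)"
| "encode_recf (Proj i) = prod_encode (2, i)"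
| "encode_recf (Comp f gs) =
    prod_encode (3, prod_encode (encode_recf f, list_encode (rev (map encode_recf gs))))"
| "encode_recf (PrimRec f g) = prod_encode (4, prod_encode (encode_recf f, encode_recf g))"
| "encode_recf (Mu f) = prod_encode (5, encode_recf f)"

fun encode_frame :: "frame \<Rightarrow> nat" where
  "encode_frame (CompF f gs xs ys) =
    prod_encode (0, prod_encode (prod_encode (encode_recf f, list_encode (map encode_recf gs)),
      prod_encode (list_encode xs, list_encode ys)))"
| "encode_frame (RecF g n xs) =
    prod_encode (1, prod_encode (encode_recf g, prod_encode (n, list_encode xs)))"
| "encode_frame (MuF f m xs) =
    prod_encode (2, prod_encode (encode_recf f, prod_encode (m, list_encode xs)))"

text \<open>List operations on the codes of \<open>list_encode\<close>, where 0 codes the empty list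
  and a nonempty list is the successor of a pair.\<close>

definition code_cons :: "nat \<Rightarrow> nat \<Rightarrow> nat" where "code_cons x l = Suc (prod_encode (x, l))"
definition code_hd :: "nat \<Rightarrow> nat" where "code_hd l = pfst (l - 1)"
definition code_tl :: "nat \<Rightarrow> nat" where "code_tl l = psnd (l - 1)"

definition code_eval :: "nat \<Rightarrow> nat \<Rightarrow> nat \<Rightarrow> nat" where
  "code_eval p xs K = prod_encode (0, prod_encode (p, prod_encode (xs, K)))"
definition code_args :: "nat \<Rightarrow> nat \<Rightarrow> nat \<Rightarrow> nat \<Rightarrow> nat \<Rightarrow> nat" where
  "code_args f gs xs ys K =
    prod_encode (1, prod_encode (prod_encode (f, gs), prod_encode (prod_encode (xs, ys), K)))"
definition code_ret :: "nat \<Rightarrow> nat \<Rightarrow> nat" where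
  "code_ret v K = prod_encode (2, prod_encode (v, K))"

fun encode_state :: "state \<Rightarrow> nat" where
  "encode_state (Eval p xs K) =
    code_eval (encode_recf p) (list_encode xs) (list_encode (map encode_frame K))"
| "encode_state (Args f gs xs ys K) =
    code_args (encode_recf f) (list_encode (map encode_recf gs)) (list_encode xs) (list_encode ys)
      (list_encode (map encode_frame K))"
| "encode_state (Ret v K) = code_ret v (list_encode (map encode_frame K))"

text \<open>The case analysis on tags mirrors \<open>step\<close>. The last branch serves
  \<open>Mu\<close> and also absorbs tags that no program has, which keeps the function
  total.\<close>

definition step_eval :: "nat \<Rightarrow> nat \<Rightarrow> nat \<Rightarrow> nat" where
  "step_eval p xs K =
    (if pfst p = 0 then code_ret 0 K
     else if pfst p = 1 then
       if xs \<noteq> 0 \<and> code_tl xs = 0 then code_ret (Suc (code_hd xs)) K else code_eval p xs K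
     else if pfst p = 2 then
       if xs = 0 then code_eval p xs K
       else if psnd p = 0 then code_ret (code_hd xs) K
       else code_eval (prod_encode (2, psnd p - 1)) (code_tl xs) K
     else if pfst p = 3 then code_args (pfst (psnd p)) (psnd (psnd p)) xs 0 K
     else if pfst p = 4 then
       if xs = 0 then code_eval p xs K
       else if code_hd xs = 0 then code_eval (pfst (psnd p)) (code_tl xs) K
       else code_eval p (code_cons (code_hd xs - 1) (code_tl xs))
         (code_cons (prod_encode (1, prod_encode (psnd (psnd p),
           prod_encode (code_hd xs - 1, code_tl xs)))) K)
     else code_eval (psnd p) (code_cons 0 xs)
       (code_cons (prod_encode (2, prod_encode (psnd p, prod_encode (0, xs)))) K))"

definition step_args :: "nat \<Rightarrow> nat \<Rightarrow> nat \<Rightarrow> nat \<Rightarrow> nat \<Rightarrow> nat" where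
  "step_args f gs xs ys K =
    (if gs = 0 then code_eval f ys K
     else code_eval (code_hd gs) xs (code_cons (prod_encode (0, prod_encode
       (prod_encode (f, code_tl gs), prod_encode (xs, ys)))) K))"

definition step_frame :: "nat \<Rightarrow> nat \<Rightarrow> nat \<Rightarrow> nat \<Rightarrow> nat" where
  "step_frame v t d K =
    (if t = 0 then
       code_args (pfst (pfst d)) (psnd (pfst d)) (pfst (psnd d)) (code_cons v (psnd (psnd d))) K
     else if t = 1 then
       code_eval (pfst d) (code_cons (pfst (psnd d)) (code_cons v (psnd (psnd d)))) K
     else if v = 0 then code_ret (pfst (psnd d)) K
     else code_eval (pfst d) (code_cons (Suc (pfst (psnd d))) (psnd (psnd d)))
       (code_cons (prod_encode (2, prod_encode (pfst d,
         prod_encode (Suc (pfst (psnd d)), psnd (psnd d))))) K))"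

definition step_ret :: "nat \<Rightarrow> nat \<Rightarrow> nat" where
  "step_ret v K =
    (if K = 0 then code_ret v K
     else step_frame v (pfst (code_hd K)) (psnd (code_hd K)) (code_tl K))"

definition step_code :: "nat \<Rightarrow> nat" where
  "step_code z =
    (if pfst z = 0 then step_eval (pfst (psnd z)) (pfst (psnd (psnd z))) (psnd (psnd (psnd z)))
     else if pfst z = 1 then
       step_args (pfst (pfst (psnd z))) (psnd (pfst (psnd z)))
         (pfst (pfst (psnd (psnd z)))) (psnd (pfst (psnd (psnd z)))) (psnd (psnd (psnd z)))
     else step_ret (pfst (psnd z)) (psnd (psnd z)))"

lemmas code_defs = code_cons_def code_hd_def code_tl_def code_eval_def code_args_def code_ret_def

lemma step_code_encode: "step_code (encode_state a) = encode_state (step a)"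
  by (induction a rule: step.induct)
    (auto simp: step_code_def step_eval_def step_args_def step_ret_def step_frame_def code_defs rev_map
      split: list.splits nat.splits)

lemma step_code_code_ret [simp]: "step_code (code_ret v 0) = code_ret v 0"
  by (simp add: step_code_def step_ret_def code_ret_def)

lemma computable_step_code: "computable step_code"
proof -
  have tl: "recursive n (\<lambda>v. code_tl (a v))" and hd: "recursive n (\<lambda>v. code_hd (a v))"
    if "recursive n a" for a n
    unfolding code_defs by (intro recursive_pair_intros that)+
  have cons: "recursive n (\<lambda>v. code_cons (a v) (b v))" and ret: "recursive n (\<lambda>v. code_ret (a v) (b v))"
    if "recursive n a" "recursive n b" for n a b
    unfolding code_defs by (intro recursive_pair_intros that)+
  have eval: "recursive n (\<lambda>v. code_eval (a v) (b v) (c v))"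
    if "recursive n a" "recursive n b" "recursive n c" for n a b c
    unfolding code_defs by (intro recursive_pair_intros that)+
  have args: "recursive n (\<lambda>v. code_args (a v) (b v) (c v) (d v) (e v))"
    if "recursive n a" "recursive n b" "recursive n c" "recursive n d" "recursive n e" for n a b c d e
    unfolding code_defs by (intro recursive_pair_intros that)+
  note intros = tl hd cons ret eval args recursive_pair_intros
  have step_eval: "recursive n (\<lambda>v. step_eval (a v) (b v) (c v))"
    if "recursive n a" "recursive n b" "recursive n c" for n a b c
    unfolding step_eval_def by (intro intros that)+
  have step_args: "recursive n (\<lambda>v. step_args (a v) (b v) (c v) (d v) (e v))"
    if "recursive n a" "recursive n b" "recursive n c" "recursive n d" "recursive n e" for n a b c d e
    unfolding step_args_def by (intro intros that)+
  have step_frame: "recursive n (\<lambda>v. step_frame (a v) (b v) (c v) (d v))"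
    if "recursive n a" "recursive n b" "recursive n c" "recursive n d" for n a b c d
    unfolding step_frame_def by (intro intros that)+
  have step_ret: "recursive n (\<lambda>v. step_ret (a v) (b v))"
    if "recursive n a" "recursive n b" for n a b
    unfolding step_ret_def by (intro intros step_frame that)+
  show ?thesis
    unfolding computable_iff_recursive step_code_def
    by (intro intros step_eval step_args step_ret) simp_all
qed

text \<open>Kleene's T predicate with the output made explicit: program code \<open>e\<close> on
  input code \<open>l\<close> has halted with \<open>y\<close> after \<open>s\<close> steps. The
  stack code 0 is the empty stack.\<close>

definition runs :: "nat \<Rightarrow> nat \<Rightarrow> nat \<Rightarrow> nat \<Rightarrow> bool" where
  "runs e l s y \<longleftrightarrow> (step_code ^^ s) (code_eval e l 0) = code_ret y 0"

lemma decidable_runs: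
  assumes "recursive n e" "recursive n l" "recursive n s" "recursive n y"
  shows "decidable n (\<lambda>v. runs (e v) (l v) (s v) (y v))"
  unfolding runs_def code_eval_def code_ret_def
  by (intro recursive_pair_intros recursive_funpow computable_step_code assms)

text \<open>A halted configuration is a fixed point of \<open>step_code\<close>, so the later of two
  stages still shows the output of the earlier one.\<close>

lemma runs_unique:
  assumes "runs e l s y" "runs e l s' y'"
  shows "y = y'"
proof -
  have halt: "(step_code ^^ k) (code_ret v 0) = code_ret v 0" for k v
    by (induction k) simp_all
  have "y = y'" if "runs e l s y" "runs e l s' y'" "s \<le> s'" for s s' y y'
  proof -
    have "(step_code ^^ s') (code_eval e l 0) = (step_code ^^ (s' - s)) ((step_code ^^ s) (code_eval e l 0))"
      using that(3) by (metis comp_apply funpow_add le_add_diff_inverse2)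
    then show ?thesis using that halt unfolding runs_def by (simp add: code_ret_def)
  qed
  then show ?thesis using assms by (metis nat_le_linear)
qed

lemma encode_state_eq_Ret: "encode_state a = code_ret y 0 \<longleftrightarrow> a = Ret y []"
proof -
  have "list_encode xs = 0 \<longleftrightarrow> xs = []" for xs by (cases xs) auto
  then show ?thesis by (cases a) (auto simp: code_defs)
qed

text \<open>Universality: the program has become a numerical argument of a single decidable
  relation. The simple set below depends on this, since it diagonalizes over all programs.\<close>

lemma computes_iff_runs:
  "computes p xs y \<longleftrightarrow> (\<exists>s. runs (encode_recf p) (list_encode xs) s y)"
proof -
  have "(step_code ^^ s) (encode_state a) = encode_state ((step ^^ s) a)" for s a
    by (induction s) (simp_all add: step_code_encode)
  from this[of _ "Eval p xs []"] show ?thesis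
    unfolding computes_iff_reach reach_def runs_def by (simp add: encode_state_eq_Ret)
qed

section \<open>Semidecidable relations\<close>

text \<open>Projections of decidable relations, with the witness in front. The witness acts as the
  stage of an enumeration, which mere domains of programs do not provide.\<close>

definition semidecidable :: "nat \<Rightarrow> (nat list \<Rightarrow> bool) \<Rightarrow> bool" where
  "semidecidable n P \<longleftrightarrow>
    (\<exists>T. decidable (Suc n) (\<lambda>ys. T (hd ys) (tl ys)) \<and> (\<forall>xs. length xs = n \<longrightarrow> (P xs \<longleftrightarrow> (\<exists>s. T s xs))))"

lemma semidecidableI:
  "decidable (Suc n) (\<lambda>ys. T (hd ys) (tl ys)) \<Longrightarrow>
    (\<And>xs. length xs = n \<Longrightarrow> P xs \<longleftrightarrow> (\<exists>s. T s xs)) \<Longrightarrow> semidecidable n P"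
  unfolding semidecidable_def by blast

lemma ce_rel_iff_semidecidable: "ce_rel E \<longleftrightarrow> semidecidable 2 (\<lambda>xs. (xs ! 0, xs ! 1) \<in> E)"
proof
  assume "ce_rel E"
  then obtain p where p: "\<And>x y. (x, y) \<in> E \<longleftrightarrow> (\<exists>z. computes p [x, y] z)"
    unfolding ce_rel_def by blast
  show "semidecidable 2 (\<lambda>xs. (xs ! 0, xs ! 1) \<in> E)"
  proof (rule semidecidableI)
    \<comment> \<open>The witness codes a pair of halting stage and output; the nested pairs are the
      list code of the two inputs.\<close>
    show "decidable (Suc 2) (\<lambda>ys. runs (encode_recf p)
        (Suc (prod_encode (tl ys ! 0, Suc (prod_encode (tl ys ! 1, 0))))) (pfst (hd ys)) (psnd (hd ys)))"
      by (intro decidable_runs recursive_pair_intros) simp_all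
    fix xs :: "nat list"
    show "(xs ! 0, xs ! 1) \<in> E \<longleftrightarrow> (\<exists>s. runs (encode_recf p)
        (Suc (prod_encode (xs ! 0, Suc (prod_encode (xs ! 1, 0))))) (pfst s) (psnd s))"
      unfolding p computes_iff_runs by simp (metis pfst_encode psnd_encode)
  qed
next
  assume "semidecidable 2 (\<lambda>xs. (xs ! 0, xs ! 1) \<in> E)"
  then obtain T where T: "decidable (Suc 2) (\<lambda>ys. T (hd ys) (tl ys))"
    and E: "\<And>xs. length xs = 2 \<Longrightarrow> (xs ! 0, xs ! 1) \<in> E \<longleftrightarrow> (\<exists>s. T s xs)"
    unfolding semidecidable_def by blast
  obtain p where "\<And>ys. length ys = Suc 2 \<Longrightarrow> computes p ys (of_bool (\<not> T (hd ys) (tl ys)))"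
    using decidable_not[OF T] unfolding decidable_def recursive_def by blast
  from this[of "[_, _, _]"] have p: "computes p [s, x, y] (of_bool (\<not> T s [x, y]))" for s x y
    by simp
  have "(x, y) \<in> E \<longleftrightarrow> (\<exists>z. computes (Mu p) [x, y] z)" for x y
  proof
    assume "(x, y) \<in> E"
    then have "\<exists>s. T s [x, y]" using E[of "[x, y]"] by simp
    then obtain s where s: "T s [x, y]" "\<And>m. m < s \<Longrightarrow> \<not> T m [x, y]"
      using exists_least_iff[of "\<lambda>s. T s [x, y]"] by blast
    have "computes (Mu p) [x, y] s"
    proof (rule computes.Mu)
      show "computes p (s # [x, y]) 0" using p[of s x y] s(1) by simp
      show "\<exists>k>0. computes p (m # [x, y]) k" if "m < s" for m
        using p[of m x y] s(2)[OF that] by auto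
    qed
    then show "\<exists>z. computes (Mu p) [x, y] z" by blast
  next
    \<comment> \<open>A successful search found a point where \<open>p\<close> returns 0; values
      being unique, \<open>T\<close> holds there.\<close>
    have uniq: "y = z" if "computes q xs y" "computes q xs z" for q xs y z
      using that computes_iff_runs runs_unique by blast
    assume "\<exists>z. computes (Mu p) [x, y] z"
    then obtain s where "computes p [s, x, y] 0" by (auto elim: computes.cases)
    with p[of s x y] uniq have "of_bool (\<not> T s [x, y]) = (0::nat)" by blast
    then have "T s [x, y]" by simp
    then show "(x, y) \<in> E" using E[of "[x, y]"] by auto
  qed
  then show "ce_rel E" unfolding ce_rel_def by blast
qed

lemma semidecidable_decidable: "decidable n P \<Longrightarrow> semidecidable n P"
  by (rule semidecidableI[where T = "\<lambda>_. P"]) (auto simp: decidable_def intro: recursive_shift)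

text \<open>Pairing merges the stage and the quantified value into one witness.\<close>

lemma semidecidable_ex:
  assumes "semidecidable (Suc n) (\<lambda>ys. P (hd ys) (tl ys))"
  shows "semidecidable n (\<lambda>xs. \<exists>y. P y xs)"
proof -
  obtain T where T: "decidable (Suc (Suc n)) (\<lambda>zs. T (hd zs) (tl zs))"
    and P: "\<And>ys. length ys = Suc n \<Longrightarrow> P (hd ys) (tl ys) \<longleftrightarrow> (\<exists>s. T s ys)"
    using assms unfolding semidecidable_def by blast
  have P: "P y xs \<longleftrightarrow> (\<exists>s. T s (y # xs))" if "length xs = n" for y xs
    using P[of "y # xs"] that by simp
  let ?gs = "(\<lambda>ys. pfst (hd ys)) # (\<lambda>ys. psnd (hd ys)) # map (\<lambda>i ys. ys ! Suc i) [0..<n]"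
  have "recursive (Suc n) (\<lambda>ys. of_bool (T (hd (map (\<lambda>g. g ys) ?gs)) (tl (map (\<lambda>g. g ys) ?gs))))"
    by (rule recursive_comp)
      (use T in \<open>auto simp: decidable_def intro!: recursive_pair_intros\<close>)
  moreover have "map (\<lambda>i. ys ! Suc i) [0..<n] = tl ys" if "length ys = Suc n" for ys :: "nat list"
    using that by (intro nth_equalityI) (auto simp: nth_tl)
  ultimately have "decidable (Suc n) (\<lambda>ys. T (pfst (hd ys)) (psnd (hd ys) # tl ys))"
    unfolding decidable_def by (subst (asm) recursive_cong) (auto simp: comp_def)
  then show ?thesis
    by (rule semidecidableI) (metis P pfst_encode psnd_encode)
qed

lemma semidecidable_conj_decidable:
  assumes "decidable n P" "semidecidable n Q"
  shows "semidecidable n (\<lambda>xs. P xs \<and> Q xs)"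
proof -
  obtain T where "decidable (Suc n) (\<lambda>ys. T (hd ys) (tl ys))"
    "\<And>xs. length xs = n \<Longrightarrow> Q xs \<longleftrightarrow> (\<exists>s. T s xs)"
    using assms(2) unfolding semidecidable_def by blast
  moreover have "decidable (Suc n) (\<lambda>ys. P (tl ys))"
    using assms(1) unfolding decidable_def by (rule recursive_shift)
  ultimately show ?thesis
    by (intro semidecidableI[where T = "\<lambda>s xs. P xs \<and> T s xs"] decidable_conj) auto
qed

lemma semidecidable_disj:
  assumes "semidecidable n P" "semidecidable n Q"
  shows "semidecidable n (\<lambda>xs. P xs \<or> Q xs)"
proof -
  obtain S T where "decidable (Suc n) (\<lambda>ys. S (hd ys) (tl ys))" "decidable (Suc n) (\<lambda>ys. T (hd ys) (tl ys))"
    "\<And>xs. length xs = n \<Longrightarrow> P xs \<longleftrightarrow> (\<exists>s. S s xs)" "\<And>xs. length xs = n \<Longrightarrow> Q xs \<longleftrightarrow> (\<exists>s. T s xs)"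
    using assms unfolding semidecidable_def by blast
  then show ?thesis
    by (intro semidecidableI[where T = "\<lambda>s xs. S s xs \<or> T s xs"] decidable_disj) auto
qed

lemma semidecidable_app2:
  assumes E: "ce_rel E" and a: "recursive n a" and b: "recursive n b"
  shows "semidecidable n (\<lambda>xs. (a xs, b xs) \<in> E)"
proof -
  obtain T where T: "decidable (Suc 2) (\<lambda>ys. T (hd ys) (tl ys))"
    and E: "\<And>xs. length xs = 2 \<Longrightarrow> (xs ! 0, xs ! 1) \<in> E \<longleftrightarrow> (\<exists>s. T s xs)"
    using E unfolding ce_rel_iff_semidecidable semidecidable_def by blast
  show ?thesis
  proof (rule semidecidableI)
    show "decidable (Suc n) (\<lambda>ys. T (hd ys) [a (tl ys), b (tl ys)])"
      using recursive_comp[of "[hd, \<lambda>ys. a (tl ys), \<lambda>ys. b (tl ys)]" "\<lambda>ys. of_bool (T (hd ys) (tl ys))" "Suc n"]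
        T recursive_shift[OF a] recursive_shift[OF b] recursive_hd[of "Suc n"]
      by (fastforce simp: decidable_def numeral_2_eq_2)
    show "(a xs, b xs) \<in> E \<longleftrightarrow> (\<exists>s. T s [a xs, b xs])" for xs
      using E[of "[a xs, b xs]"] by simp
  qed
qed

section \<open>Dark and light ceers\<close>

lemma computable_comp: "computable f \<Longrightarrow> computable g \<Longrightarrow> computable (\<lambda>x. f (g x))"
  unfolding computable_iff_recursive[of g] computable_iff_recursive[of "\<lambda>x. f (g x)"]
  by (rule recursive_app)

text \<open>One case distinction per value. This builds finitely many noneffectively chosen values
  into a program.\<close>

lemma computable_finite_table: "\<exists>t. computable t \<and> (\<forall>k<n. t k = f k)"
proof (induction n)
  case 0
  have "computable (\<lambda>_. 0)" by (simp add: computable_iff_recursive recursive_const)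
  then show ?case by blast
next
  case (Suc n)
  then obtain t where t: "computable t" "\<And>k. k < n \<Longrightarrow> t k = f k" by blast
  have "computable (\<lambda>k. if k = n then f n else t k)"
    unfolding computable_iff_recursive
    by (intro recursive_intros recursive_app[OF t(1)]) simp_all
  then show ?case
    by (rule exI[of _ "\<lambda>k. if k = n then f n else t k", OF conjI]) (simp add: t(2))
qed

lemma computable_increasing_enumeration:
  assumes P: "decidable 1 (\<lambda>xs. P (xs ! 0))" and key: "computable key"
    and inf: "infinite (key ` {w. P w})"
  obtains u where "computable u" "\<And>i. P (u i)" "strict_mono (\<lambda>i. key (u i))"
proof -
  have ex: "\<exists>w. P w \<and> n < key w" for n
  proof (rule ccontr)
    assume "\<nexists>w. P w \<and> n < key w"
    then have "key ` {w. P w} \<subseteq> {..n}" by (auto simp: not_less)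
    with inf show False using finite_subset by blast
  qed
  define nxt where "nxt n = (LEAST w. P w \<and> n < key w)" for n
  have nxt: "P (nxt n)" "n < key (nxt n)" for n
    using LeastI_ex[OF ex[of n]] unfolding nxt_def by auto
  have "decidable 2 (\<lambda>ys. P (hd ys))"
    using recursive_comp[of "[hd]" "\<lambda>xs. of_bool (P (xs ! 0))" 2] P recursive_hd[of 2]
    by (simp add: decidable_def)
  then have "recursive 1 (\<lambda>xs. LEAST w. P w \<and> xs ! 0 < key w)"
    using ex by (intro recursive_Least decidable_conj decidable_less recursive_tl_nth
        recursive_app[OF key] recursive_hd) (simp_all add: numeral_2_eq_2)
  then have c: "computable nxt"
    unfolding computable_iff_recursive nxt_def .
  \<comment> \<open>Each term is the first witness whose key exceeds that of its predecessor.
    Starting at \<open>nxt 0\<close> merely skips key 0.\<close>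
  define u where "u i = ((\<lambda>w. nxt (key w)) ^^ i) (nxt 0)" for i
  show ?thesis
  proof
    show "computable u"
      unfolding u_def computable_iff_recursive
      by (intro recursive_funpow computable_comp[OF c key] recursive_const recursive_nth) simp
    show "P (u i)" for i by (cases i) (simp_all add: u_def nxt)
    show "strict_mono (\<lambda>i. key (u i))"
      by (rule strict_mono_Suc_iff[THEN iffD2]) (simp add: u_def nxt)
  qed
qed

text \<open>The form in which darkness is used. Were there infinitely many keys, witnesses of
  \<open>P\<close> with strictly increasing keys could be enumerated effectively; their images under
  \<open>f\<close> would be pairwise inequivalent and embed \<open>Id\<close>.\<close>

lemma not_Id_reducible_finite_keys:
  assumes D: "\<not> Id \<le>\<^sub>c D" and P: "semidecidable 1 (\<lambda>xs. P (xs ! 0))"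
    and key: "computable key" and f: "computable f"
    and inj: "\<And>v w. P v \<Longrightarrow> P w \<Longrightarrow> (f v, f w) \<in> D \<Longrightarrow> key v = key w"
    and refl: "\<And>x. (x, x) \<in> D"
  shows "finite (key ` {w. P w})"
proof (rule ccontr)
  assume inf: "infinite (key ` {w. P w})"
  obtain T where T: "decidable (Suc 1) (\<lambda>ys. T (hd ys) (tl ys))"
    and PT: "\<And>xs. length xs = 1 \<Longrightarrow> P (xs ! 0) \<longleftrightarrow> (\<exists>s. T s xs)"
    using P unfolding semidecidable_def by blast
  have PT: "P x \<longleftrightarrow> (\<exists>s. T s [x])" for x using PT[of "[x]"] by simp
  \<comment> \<open>Pairs of a stage and a witness form a decidable set, on which the enumeration by
    increasing keys can search.\<close>
  let ?Q = "\<lambda>w. T (pfst w) [psnd w]"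
  have "recursive 1 (\<lambda>xs. pfst (xs ! 0))" "recursive 1 (\<lambda>xs. psnd (xs ! 0))"
    by (intro recursive_pair_intros; simp)+
  then have "decidable 1 (\<lambda>xs. ?Q (xs ! 0))"
    using recursive_comp[of "[\<lambda>xs. pfst (xs ! 0), \<lambda>xs. psnd (xs ! 0)]"
        "\<lambda>ys. of_bool (T (hd ys) (tl ys))" 1] T
    by (fastforce simp: decidable_def)
  moreover have "computable (\<lambda>w. key (psnd w))" by (rule computable_comp[OF key computable_psnd])
  moreover have "key ` {w. P w} = (\<lambda>w. key (psnd w)) ` {w. ?Q w}"
    unfolding PT by (auto simp: image_iff) (metis pfst_encode psnd_encode)
  ultimately obtain u where u: "computable u" "\<And>i. ?Q (u i)" "strict_mono (\<lambda>i. key (psnd (u i)))"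
    using inf computable_increasing_enumeration[of ?Q "\<lambda>w. key (psnd w)"] by metis
  have "(i, j) \<in> Id \<longleftrightarrow> (f (psnd (u i)), f (psnd (u j))) \<in> D" for i j
  proof
    assume "(f (psnd (u i)), f (psnd (u j))) \<in> D"
    moreover have "P (psnd (u k))" for k using u(2) PT by blast
    ultimately have "key (psnd (u i)) = key (psnd (u j))" using inj by blast
    then show "(i, j) \<in> Id" using strict_mono_eq[OF u(3)] by simp
  qed (auto intro: refl)
  moreover have "computable (\<lambda>i. f (psnd (u i)))"
    by (intro computable_comp[OF f] computable_comp[OF computable_psnd] u(1))
  ultimately show False using D unfolding reducible_def by blast
qed

lemma infinite_quotientD:
  assumes E: "equiv UNIV E" and inf: "infinite (UNIV // E)"
  shows "\<exists>c :: nat \<Rightarrow> 'a. \<forall>i j. (c i, c j) \<in> E \<longrightarrow> i = j"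
proof -
  obtain b :: "nat \<Rightarrow> 'a set" where b: "inj b" "range b \<subseteq> UNIV // E"
    using inf infinite_countable_subset by blast
  have "\<exists>x. b i = E `` {x}" for i
    using b(2) by (auto elim!: quotientE)
  then obtain c where c: "\<And>i. b i = E `` {c i}" by metis
  have "i = j" if "(c i, c j) \<in> E" for i j
  proof (rule injD[OF b(1)])
    show "b i = b j" unfolding c by (rule equiv_class_eq[OF E that])
  qed
  then show ?thesis by blast
qed

lemma infinite_quotientI:
  fixes c :: "nat \<Rightarrow> 'a"
  assumes E: "equiv UNIV E" and c: "\<And>i j. (c i, c j) \<in> E \<Longrightarrow> i = j"
  shows "infinite (UNIV // E)"
proof -
  have "inj (\<lambda>i. E `` {c i})"
    by (rule injI) (metis E UNIV_I c eq_equiv_class)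
  then have "infinite (range (\<lambda>i. E `` {c i}))" using finite_imageD infinite_UNIV_nat by blast
  moreover have "range (\<lambda>i. E `` {c i}) \<subseteq> UNIV // E" by (auto intro: quotientI)
  ultimately show ?thesis by (rule infinite_super[rotated])
qed

section \<open>Ceers and their uniform joins\<close>

lemma ceer_refl: "ceer E \<Longrightarrow> (x, x) \<in> E"
  and ceer_sym: "ceer E \<Longrightarrow> (x, y) \<in> E \<Longrightarrow> (y, x) \<in> E"
  and ceer_trans: "ceer E \<Longrightarrow> (x, y) \<in> E \<Longrightarrow> (y, z) \<in> E \<Longrightarrow> (x, z) \<in> E"
  unfolding ceer_def equiv_def refl_on_def by (auto dest: symD transD)

lemma uniform_join_iff:
  "(x, y) \<in> E \<oplus>\<^sub>c R \<longleftrightarrow>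
    even x \<and> even y \<and> (x div 2, y div 2) \<in> E \<or> odd x \<and> odd y \<and> (x div 2, y div 2) \<in> R"
proof
  show "(x, y) \<in> E \<oplus>\<^sub>c R \<Longrightarrow>
      even x \<and> even y \<and> (x div 2, y div 2) \<in> E \<or> odd x \<and> odd y \<and> (x div 2, y div 2) \<in> R"
    by (auto simp: uniform_join_def)
  show "even x \<and> even y \<and> (x div 2, y div 2) \<in> E \<or> odd x \<and> odd y \<and> (x div 2, y div 2) \<in> R \<Longrightarrow>
      (x, y) \<in> E \<oplus>\<^sub>c R"
    unfolding uniform_join_def by (elim disjE conjE evenE oddE) auto
qed

lemma ceer_Id: "ceer Id"
proof -
  have "semidecidable 2 (\<lambda>xs. (xs ! 0, xs ! 1) \<in> Id)"
    by (auto intro!: semidecidable_decidable recursive_intros)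
  then show ?thesis
    by (simp add: ceer_def ce_rel_iff_semidecidable equiv_def refl_on_def sym_Id trans_Id)
qed

lemma ceer_uniform_join:
  assumes E: "ceer E" and R: "ceer R" shows "ceer (E \<oplus>\<^sub>c R)"
proof -
  have "equiv UNIV (E \<oplus>\<^sub>c R)"
  proof (intro equivI refl_onI symI transI)
    fix x y z
    show "(x, x) \<in> E \<oplus>\<^sub>c R" using ceer_refl[OF E] ceer_refl[OF R] by (auto simp: uniform_join_iff)
    show "(x, y) \<in> E \<oplus>\<^sub>c R \<Longrightarrow> (y, x) \<in> E \<oplus>\<^sub>c R"
      using ceer_sym[OF E] ceer_sym[OF R] by (auto simp: uniform_join_iff)
    show "(x, y) \<in> E \<oplus>\<^sub>c R \<Longrightarrow> (y, z) \<in> E \<oplus>\<^sub>c R \<Longrightarrow> (x, z) \<in> E \<oplus>\<^sub>c R"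
      using ceer_trans[OF E] ceer_trans[OF R] by (auto simp: uniform_join_iff)
  qed simp_all
  moreover have "semidecidable 2 (\<lambda>xs. (xs ! 0, xs ! 1) \<in> E \<oplus>\<^sub>c R)"
    unfolding uniform_join_iff conj_assoc[symmetric]
    by (intro semidecidable_disj semidecidable_conj_decidable semidecidable_app2 recursive_intros)
      (use E R in \<open>simp_all add: ceer_def\<close>)
  ultimately show ?thesis by (simp add: ceer_def ce_rel_iff_semidecidable)
qed

lemma computable_double: "computable (\<lambda>x. 2 * x)"
  and computable_double_Suc: "computable (\<lambda>x. 2 * x + 1)"
  unfolding computable_iff_recursive by (intro recursive_intros; simp)+

lemma reducible_uniform_join_left: "E \<le>\<^sub>c E \<oplus>\<^sub>c R"
  unfolding reducible_def
  by (rule exI[of _ "\<lambda>x. 2 * x"]) (simp add: computable_double uniform_join_iff)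

lemma reducible_uniform_join_right: "R \<le>\<^sub>c E \<oplus>\<^sub>c R"
  unfolding reducible_def
  by (rule exI[of _ "\<lambda>x. 2 * x + 1"])
    (use computable_double_Suc in \<open>simp add: uniform_join_iff\<close>)

lemma uniform_join_mono_right:
  assumes "R \<le>\<^sub>c S" shows "E \<oplus>\<^sub>c R \<le>\<^sub>c E \<oplus>\<^sub>c S"
proof -
  obtain f where f: "computable f" "\<And>x y. (x, y) \<in> R \<longleftrightarrow> (f x, f y) \<in> S"
    using assms unfolding reducible_def by blast
  let ?h = "\<lambda>x. if even x then x else 2 * f (x div 2) + 1"
  have "computable ?h"
    unfolding computable_iff_recursive
    by (intro recursive_intros recursive_app[OF f(1)]) simp_all
  moreover have "(x, y) \<in> E \<oplus>\<^sub>c R \<longleftrightarrow> (?h x, ?h y) \<in> E \<oplus>\<^sub>c S" for x y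
    by (auto simp: uniform_join_iff f(2))
  ultimately show ?thesis unfolding reducible_def by blast
qed

text \<open>Parity splits an embedding of \<open>Id\<close> decidably into a part inside
  \<open>D\<close> and a part inside \<open>C\<close>; darkness makes both finite.\<close>

lemma dark_uniform_join:
  assumes D: "dark D" and C: "dark C" shows "dark (D \<oplus>\<^sub>c C)"
proof -
  have ceer: "ceer D" "ceer C" and nId: "\<not> Id \<le>\<^sub>c D" "\<not> Id \<le>\<^sub>c C"
    using D C by (auto simp: dark_def)
  have ceer': "ceer (D \<oplus>\<^sub>c C)" using ceer by (rule ceer_uniform_join)
  have "equiv UNIV D" "infinite (UNIV // D)" using D by (simp_all add: dark_def ceer_def)
  then obtain c :: "nat \<Rightarrow> nat" where c: "\<And>i j. (c i, c j) \<in> D \<Longrightarrow> i = j"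
    using infinite_quotientD by metis
  have inf: "infinite (UNIV // (D \<oplus>\<^sub>c C))"
    by (rule infinite_quotientI[of _ "\<lambda>i. 2 * c i"])
      (use ceer' c in \<open>auto simp: ceer_def uniform_join_iff\<close>)
  have "\<not> Id \<le>\<^sub>c D \<oplus>\<^sub>c C"
  proof
    assume "Id \<le>\<^sub>c D \<oplus>\<^sub>c C"
    then obtain f where f: "computable f" "\<And>x y. x = y \<longleftrightarrow> (f x, f y) \<in> D \<oplus>\<^sub>c C"
      unfolding reducible_def by auto
    have f2: "computable (\<lambda>x. f x div 2)" by (rule computable_comp[OF computable_div_2 f(1)])
    have id: "computable (\<lambda>x. x)" by (simp add: computable_iff_recursive recursive_nth)
    have even: "decidable 1 (\<lambda>xs. even (f (xs ! 0)))"
      by (intro recursive_intros recursive_app[OF f(1)]) simp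
    have "finite ((\<lambda>x. x) ` {x. even (f x)})"
      by (rule not_Id_reducible_finite_keys[OF nId(1) semidecidable_decidable[OF even] id f2])
        (simp_all add: f(2) uniform_join_iff ceer_refl[OF ceer(1)])
    moreover have "finite ((\<lambda>x. x) ` {x. odd (f x)})"
      by (rule not_Id_reducible_finite_keys[OF nId(2) semidecidable_decidable[OF decidable_not[OF even]] id f2])
        (simp_all add: f(2) uniform_join_iff ceer_refl[OF ceer(2)])
    ultimately have "finite ({x. even (f x)} \<union> {x. odd (f x)})" by simp
    moreover have "{x. even (f x)} \<union> {x. odd (f x)} = UNIV" by auto
    ultimately show False by simp
  qed
  then show ?thesis using ceer' inf by (simp add: dark_def)
qed

text \<open>If the class of \<open>y\<close> is missed, then \<open>y, f y, f (f y), \<dots>\<close> are pairwise inequivalent.\<close>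

lemma self_reduction_onto:
  assumes D: "ceer D" "\<not> Id \<le>\<^sub>c D" and f: "computable f"
    and red: "\<And>x y. (x, y) \<in> D \<longleftrightarrow> (f x, f y) \<in> D"
  shows "\<exists>x. (f x, y) \<in> D"
proof (rule ccontr)
  assume miss: "\<nexists>x. (f x, y) \<in> D"
  \<comment> \<open>As \<open>f\<close> reflects equivalence, \<open>i\<close> can be lowered to 0,
    where \<open>y\<close> would be equivalent to a value of \<open>f\<close>.\<close>
  have neq: "((f ^^ i) y, (f ^^ (i + Suc k)) y) \<notin> D" for i k
  proof (induction i)
    case 0
    then show ?case using miss ceer_sym[OF D(1)] by auto
  next
    case (Suc i)
    then show ?case using red by simp
  qed
  have "i = j" if "((f ^^ i) y, (f ^^ j) y) \<in> D" for i j
    using neq that ceer_sym[OF D(1)] by (metis less_iff_Suc_add linorder_neqE_nat add_Suc_right)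
  then have "(i, j) \<in> Id \<longleftrightarrow> ((f ^^ i) y, (f ^^ j) y) \<in> D" for i j
    using ceer_refl[OF D(1)] by auto
  moreover have "computable (\<lambda>i. (f ^^ i) y)"
    unfolding computable_iff_recursive
    by (intro recursive_funpow f recursive_const recursive_nth) simp
  ultimately show False using D(2) unfolding reducible_def by blast
qed

lemma odd_div_2_eq: "odd x \<Longrightarrow> odd y \<Longrightarrow> x div 2 = y div 2 \<Longrightarrow> x = y" for x y :: nat
  by presburger

text \<open>The classes of \<open>D\<close> sent to \<open>Id\<close> are finitely many; rerouted to classes used by \<open>C\<close>, they turn
  the reduction into a self-reduction of \<open>D\<close> that is not onto.\<close>

lemma dark_join_not_reducible_join_Id:
  assumes D: "dark D" and C: "dark C" shows "\<not> D \<oplus>\<^sub>c C \<le>\<^sub>c D \<oplus>\<^sub>c Id"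
proof
  assume "D \<oplus>\<^sub>c C \<le>\<^sub>c D \<oplus>\<^sub>c Id"
  then obtain g where g: "computable g" "\<And>x y. (x, y) \<in> D \<oplus>\<^sub>c C \<longleftrightarrow> (g x, g y) \<in> D \<oplus>\<^sub>c Id"
    unfolding reducible_def by blast
  have ceer: "ceer D" "ceer C" and nId: "\<not> Id \<le>\<^sub>c D" "\<not> Id \<le>\<^sub>c C"
    using D C by (auto simp: dark_def)
  have gD: "(x, y) \<in> D \<longleftrightarrow> (g (2 * x), g (2 * y)) \<in> D \<oplus>\<^sub>c Id" for x y
    unfolding g(2)[symmetric] by (simp add: uniform_join_iff)
  have gC: "(x, y) \<in> C \<longleftrightarrow> (g (2 * x + 1), g (2 * y + 1)) \<in> D \<oplus>\<^sub>c Id" for x y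
    unfolding g(2)[symmetric] by (simp add: uniform_join_iff)
  have gDC: "(g (2 * x), g (2 * y + 1)) \<notin> D \<oplus>\<^sub>c Id" for x y
    unfolding g(2)[symmetric] by (simp add: uniform_join_iff)
  have id: "computable (\<lambda>x. x)" by (simp add: computable_iff_recursive recursive_nth)
  have g0: "computable (\<lambda>x. g (2 * x))" by (rule computable_comp[OF g(1) computable_double])
  have g1: "computable (\<lambda>x. g (2 * x + 1))" by (rule computable_comp[OF g(1) computable_double_Suc])
  \<comment> \<open>On odd numbers \<open>D \<oplus>\<^sub>c Id\<close> is equality, so
    \<open>D\<close>-equivalent points sent to odd values share the same value, which can serve as
    key.\<close>
  have "finite ((\<lambda>x. g (2 * x)) ` {x. odd (g (2 * x))})"
  proof (rule not_Id_reducible_finite_keys[OF nId(1) _ g0 id])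
    show "semidecidable 1 (\<lambda>xs. odd (g (2 * (xs ! 0))))"
      by (intro semidecidable_decidable recursive_intros recursive_app[OF g0]) simp
    show "g (2 * x) = g (2 * y)" if "odd (g (2 * x))" "odd (g (2 * y))" "(x, y) \<in> D" for x y
      using that unfolding gD[of x y] uniform_join_iff by (auto dest: odd_div_2_eq)
  qed (rule ceer_refl[OF ceer(1)])
  then obtain n where n: "\<And>x. odd (g (2 * x)) \<Longrightarrow> g (2 * x) div 2 < n"
    using finite_nat_set_iff_bounded[of "(\<lambda>x. g (2 * x)) ` {x. odd (g (2 * x))}"]
    by (metis (mono_tags, lifting) div_le_dividend imageI le_less_trans mem_Collect_eq)
  have fin: "finite ((\<lambda>x. g (2 * x + 1)) ` {x. odd (g (2 * x + 1))})"
  proof (rule not_Id_reducible_finite_keys[OF nId(2) _ g1 id])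
    show "semidecidable 1 (\<lambda>xs. odd (g (2 * (xs ! 0) + 1)))"
      by (intro semidecidable_decidable recursive_intros recursive_app[OF g1]) simp
    show "g (2 * x + 1) = g (2 * y + 1)"
      if "odd (g (2 * x + 1))" "odd (g (2 * y + 1))" "(x, y) \<in> C" for x y
      using that unfolding gC[of x y] uniform_join_iff by (auto dest: odd_div_2_eq)
  qed (rule ceer_refl[OF ceer(2)])
  have "equiv UNIV C" "infinite (UNIV // C)" using C by (simp_all add: dark_def ceer_def)
  then obtain c :: "nat \<Rightarrow> nat" where c: "\<And>i j. (c i, c j) \<in> C \<Longrightarrow> i = j"
    using infinite_quotientD by metis
  have "inj (\<lambda>i. g (2 * c i + 1))"
  proof (rule injI)
    fix i j assume "g (2 * c i + 1) = g (2 * c j + 1)"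
    then have "(c i, c j) \<in> C"
      using ceer_refl[OF ceer_uniform_join[OF ceer(1) ceer_Id]] unfolding gC by simp
    then show "i = j" by (rule c)
  qed
  then have "finite {i. odd (g (2 * c i + 1))}"
    using finite_subset[OF _ fin, of "(\<lambda>i. g (2 * c i + 1)) ` {i. odd (g (2 * c i + 1))}"]
    by (auto dest!: finite_imageD intro: inj_on_subset)
  then obtain m where "\<And>i. odd (g (2 * c i + 1)) \<Longrightarrow> i < m"
    using finite_nat_set_iff_bounded[of "{i. odd (g (2 * c i + 1))}"] by blast
  then have even: "even (g (2 * c (m + i) + 1))" for i by (metis not_add_less1)
  \<comment> \<open>Past \<open>m\<close> the representatives of \<open>C\<close> are sent to the
    \<open>D\<close> side. The classes of the \<open>b i\<close> are pairwise distinct and, by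
    \<open>gDC\<close>, missed by all points coming from \<open>D\<close>.\<close>
  define b where "b i = g (2 * c (m + i) + 1) div 2" for i
  have b: "i = j" if "(b i, b j) \<in> D" for i j
    using that even[of i] even[of j] gC[of "c (m + i)" "c (m + j)"] c[of "m + i" "m + j"]
    by (simp add: b_def uniform_join_iff)
  have gb: "even (g (2 * x)) \<Longrightarrow> (g (2 * x) div 2, b i) \<notin> D" for x i
    using even[of i] gDC[of x "c (m + i)"] by (simp add: b_def uniform_join_iff)
  then have bg: "even (g (2 * x)) \<Longrightarrow> (b i, g (2 * x) div 2) \<notin> D" for x i
    using ceer_sym[OF ceer(1)] by blast
  \<comment> \<open>The choice of \<open>c\<close>, and with it \<open>b\<close>, need not be
    effective; only the \<open>n\<close> values required for rerouting are stored.\<close>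
  obtain t where t: "computable t" "\<And>k. k < n \<Longrightarrow> t k = b k"
    using computable_finite_table by metis
  define f where "f x = (if even (g (2 * x)) then g (2 * x) div 2 else t (g (2 * x) div 2))" for x
  have fc: "computable f"
    unfolding computable_iff_recursive f_def
    by (intro recursive_intros recursive_app[OF g(1)] recursive_app[OF t(1)]) simp_all
  have bb: "(b i, b j) \<in> D \<longleftrightarrow> i = j" for i j using b ceer_refl[OF ceer(1)] by blast
  have "(x, y) \<in> D \<longleftrightarrow> (f x, f y) \<in> D" for x y
    by (cases "even (g (2 * x))"; cases "even (g (2 * y))")
      (simp_all add: f_def gD[of x y] uniform_join_iff t n bb gb bg)
  then obtain x where "(f x, b n) \<in> D"
    using self_reduction_onto[OF ceer(1) nId(1) fc] by blast
  \<comment> \<open>Rerouting uses only \<open>b k\<close> with \<open>k < n\<close>, and unrerouted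
    values avoid every \<open>b i\<close>, so the class of \<open>b n\<close> is missed.\<close>
  then show False
    using n[of x] by (cases "even (g (2 * x))") (simp_all add: f_def t bb gb)
qed

text \<open>Only finitely many \<open>g k\<close> are equivalent to some \<open>f y\<close>, and \<open>Id\<close> can do without them.\<close>

lemma join_Id_least:
  assumes D: "ceer D" "\<not> Id \<le>\<^sub>c D" and S: "ceer S" and DS: "D \<le>\<^sub>c S" and IdS: "Id \<le>\<^sub>c S"
  shows "D \<oplus>\<^sub>c Id \<le>\<^sub>c S"
proof -
  obtain f where f: "computable f" "\<And>x y. (x, y) \<in> D \<longleftrightarrow> (f x, f y) \<in> S"
    using DS unfolding reducible_def by blast
  obtain g where g: "computable g" "\<And>x y. x = y \<longleftrightarrow> (g x, g y) \<in> S"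
    using IdS unfolding reducible_def by auto
  \<comment> \<open>A number \<open>w\<close> codes a pair \<open>(k, y)\<close> at which the two
    images meet. Equivalent \<open>y\<close> force the same \<open>k\<close>, so \<open>k\<close> is
    a key in the sense of \<open>not_Id_reducible_finite_keys\<close>.\<close>
  have sd: "semidecidable 1 (\<lambda>xs. (g (pfst (xs ! 0)), f (psnd (xs ! 0))) \<in> S)"
    by (intro semidecidable_app2 recursive_pair_intros recursive_app[OF f(1)] recursive_app[OF g(1)])
      (use S in \<open>simp_all add: ceer_def\<close>)
  have inj: "pfst v = pfst w"
    if "(g (pfst v), f (psnd v)) \<in> S" "(g (pfst w), f (psnd w)) \<in> S" "(psnd v, psnd w) \<in> D" for v w
    using that f(2) g(2) ceer_sym[OF S] ceer_trans[OF S] by metis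
  have "finite (pfst ` {w. (g (pfst w), f (psnd w)) \<in> S})"
    by (rule not_Id_reducible_finite_keys[OF D(2) sd computable_pfst computable_psnd])
      (fact inj ceer_refl[OF D(1)])+
  then obtain n where "\<And>w. (g (pfst w), f (psnd w)) \<in> S \<Longrightarrow> pfst w < n"
    using finite_nat_set_iff_bounded by (metis (mono_tags, lifting) imageI mem_Collect_eq)
  from this[of "prod_encode (_, _)"] have n: "(g k, f y) \<in> S \<Longrightarrow> k < n" for k y by simp
  \<comment> \<open>Shifting the argument of \<open>g\<close> by \<open>n\<close> moves the copy of
    \<open>Id\<close> past all meeting points.\<close>
  let ?h = "\<lambda>x. if even x then f (x div 2) else g (x div 2 + n)"
  have "computable ?h"
    unfolding computable_iff_recursive
    by (intro recursive_intros recursive_app[OF f(1)] recursive_app[OF g(1)]) simp_all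
  moreover have "(g (k + n), f y) \<notin> S" "(f y, g (k + n)) \<notin> S" for k y
    using n ceer_sym[OF S] by (metis not_add_less2)+
  then have "(x, y) \<in> D \<oplus>\<^sub>c Id \<longleftrightarrow> (?h x, ?h y) \<in> S" for x y
    using g(2)[of "x div 2 + n" "y div 2 + n"] by (auto simp: uniform_join_iff f(2))
  ultimately show ?thesis unfolding reducible_def by blast
qed

section \<open>A dark ceer\<close>

text \<open>Program \<open>e\<close> puts those of its first \<open>4 ^ Suc e + 2\<close> values into \<open>post_set\<close> that are at least
  \<open>4 ^ Suc e\<close>: at least two
  if it is total and injective, but too few in all for \<open>post_set\<close> to be cofinite.\<close>

definition enters :: "nat \<Rightarrow> nat \<Rightarrow> nat \<Rightarrow> nat \<Rightarrow> bool" where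
  "enters e i s y \<longleftrightarrow> i < 4 ^ Suc e + 2 \<and> 4 ^ Suc e \<le> y \<and> runs e (Suc (prod_encode (i, 0))) s y"

definition post_set :: "nat set" where
  "post_set = {y. \<exists>e i s. enters e i s y}"

definition post_ceer :: "nat rel" where
  "post_ceer = {(x, y). x = y \<or> x \<in> post_set \<and> y \<in> post_set}"

lemma ceer_post_ceer: "ceer post_ceer"
proof -
  have mem: "y \<in> post_set \<longleftrightarrow> (\<exists>w. enters (pfst w) (pfst (psnd w)) (psnd (psnd w)) y)" for y
    unfolding post_set_def by simp (metis pfst_encode psnd_encode)
  have eq: "(x, y) \<in> post_ceer \<longleftrightarrow> x = y \<or>
      (\<exists>v w. enters (pfst v) (pfst (psnd v)) (psnd (psnd v)) x \<and>
        enters (pfst w) (pfst (psnd w)) (psnd (psnd w)) y)" for x y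
    unfolding post_ceer_def mem by auto
  have "semidecidable 2 (\<lambda>xs. (xs ! 0, xs ! 1) \<in> post_ceer)"
    unfolding eq enters_def
    by (intro semidecidable_disj semidecidable_ex semidecidable_decidable decidable_runs
        recursive_pair_intros) simp_all
  moreover have "equiv UNIV post_ceer"
    by (intro equivI refl_onI symI transI) (auto simp: post_ceer_def)
  ultimately show ?thesis by (simp add: ceer_def ce_rel_iff_semidecidable)
qed

text \<open>Below \<open>4 ^ Suc k\<close> only programs \<open>e < k\<close> contribute, each at
  most \<open>4 ^ Suc e + 2\<close> values. These add up to at most \<open>4 ^ Suc k - k\<close>, so
  at least \<open>k\<close> numbers stay outside for every \<open>k\<close>.\<close>

lemma infinite_compl_post_set: "infinite (- post_set)"
proof
  assume fin: "finite (- post_set)"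
  define k where "k = Suc (card (- post_set))"
  define I where "I = (SIGMA e:{..<k}. {..<4 ^ Suc e + 2::nat})"
  \<comment> \<open>Where program \<open>e\<close> has no value at \<open>i\<close> this is
    arbitrary, which can only enlarge the image of \<open>I\<close>.\<close>
  define val where "val = (\<lambda>(e, i). THE y. \<exists>s. runs e (Suc (prod_encode (i, 0))) s y)"
  have "post_set \<inter> {..<4 ^ Suc k} \<subseteq> val ` I"
  proof
    fix y assume "y \<in> post_set \<inter> {..<4 ^ Suc k}"
    then obtain e i s where e: "i < 4 ^ Suc e + 2" "4 ^ Suc e \<le> y" "y < 4 ^ Suc k"
      "runs e (Suc (prod_encode (i, 0))) s y"
      unfolding post_set_def enters_def by blast
    have "val (e, i) = y"
      unfolding val_def prod.case by (rule the_equality) (use e(4) runs_unique in blast)+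
    moreover have "e < k"
      using le_less_trans[OF e(2,3)] by (simp only: power_strict_increasing_iff)
    ultimately show "y \<in> val ` I" using e(1) unfolding I_def by force
  qed
  then have "card (post_set \<inter> {..<4 ^ Suc k}) \<le> card I"
    by (intro surj_card_le) (simp_all add: I_def)
  also have "card I = (\<Sum>e<k. 4 ^ Suc e + 2)" unfolding I_def by simp
  also have "(\<Sum>e<k. 4 ^ Suc e + 2) + k \<le> (4 ^ Suc k :: nat)"
  proof (induction k)
    case (Suc k)
    have "(1::nat) \<le> 4 ^ k" by simp
    with Suc show ?case unfolding sum.lessThan_Suc power_Suc by linarith
  qed simp
  finally have A: "card (post_set \<inter> {..<4 ^ Suc k}) + k \<le> 4 ^ Suc k" by simp
  have "(4::nat) ^ Suc k = card ((post_set \<inter> {..<4 ^ Suc k}) \<union> (- post_set \<inter> {..<4 ^ Suc k}))"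
    by (simp add: Int_Un_distrib2[symmetric])
  also have "\<dots> \<le> card (post_set \<inter> {..<4 ^ Suc k}) + card (- post_set \<inter> {..<4 ^ Suc k})"
    by (rule card_Un_le)
  also have "card (- post_set \<inter> {..<4 ^ Suc k}) \<le> card (- post_set)"
    using fin by (intro card_mono) auto
  finally show False using A k_def by simp
qed

text \<open>A reduction of \<open>Id\<close> would be injective, and the program computing it would
  itself put two of its values into \<open>post_set\<close>, where they are equivalent.\<close>

lemma dark_post_ceer: "dark post_ceer"
proof -
  obtain c :: "nat \<Rightarrow> nat" where "inj c" "range c \<subseteq> - post_set"
    using infinite_countable_subset[OF infinite_compl_post_set] by blast
  then have inf: "infinite (UNIV // post_ceer)"
    using ceer_post_ceer
    by (intro infinite_quotientI[of _ c]) (auto simp: ceer_def post_ceer_def inj_eq)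
  have "\<not> Id \<le>\<^sub>c post_ceer"
  proof
    assume "Id \<le>\<^sub>c post_ceer"
    then obtain f p where p: "\<And>x. computes p [x] (f x)"
      and f: "\<And>x y. x = y \<longleftrightarrow> (f x, f y) \<in> post_ceer"
      unfolding reducible_def computable_def by auto
    define h :: nat where "h = 4 ^ Suc (encode_recf p)"
    have mem: "f i \<in> post_set" if "i < h + 2" "h \<le> f i" for i
      using p[of i] that unfolding computes_iff_runs post_set_def enters_def h_def by auto
    define B where "B = {i. i < h + 2 \<and> h \<le> f i}"
    have inj: "inj f" by (rule injI, rule f[THEN iffD2]) (simp add: post_ceer_def)
    \<comment> \<open>By injectivity at most \<open>h\<close> of the first \<open>h + 2\<close>
      values lie below \<open>h\<close>, which leaves two indices in \<open>B\<close>.\<close>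
    have "card {i. i < h + 2 \<and> f i < h} \<le> card {..<h}"
      using inj by (intro card_inj_on_le[of f]) (auto intro: inj_on_subset)
    moreover have "{..<h + 2} = {i. i < h + 2 \<and> f i < h} \<union> B" by (auto simp: B_def)
    then have "card {..<h + 2} \<le> card {i. i < h + 2 \<and> f i < h} + card B"
      using card_Un_le by metis
    ultimately have "\<not> card B \<le> Suc 0" unfolding card_lessThan by linarith
    moreover have "finite B" by (simp add: B_def)
    ultimately obtain i j where "i \<in> B" "j \<in> B" "i \<noteq> j"
      by (auto simp: card_le_Suc0_iff_eq)
    then show False using mem f[of i j] by (auto simp: B_def post_ceer_def)
  qed
  then show ?thesis using inf ceer_post_ceer by (simp add: dark_def)
qed

theorem theorem6p17:
  "\<exists>E1 E2 R :: nat rel.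
     dark E1 \<and> light E2 \<and> \<not> E1 \<le>\<^sub>c E2 \<and> \<not> E2 \<le>\<^sub>c E1 \<and>
     ceer R \<and> degree_lub R E1 E2 \<and> R <\<^sub>c E1 \<oplus>\<^sub>c E2"
proof (intro exI conjI)
  let ?E = post_ceer
  let ?E1 = "?E \<oplus>\<^sub>c ?E" and ?E2 = "?E \<oplus>\<^sub>c Id"
  let ?R = "?E1 \<oplus>\<^sub>c Id"
  have E: "ceer ?E" by (rule ceer_post_ceer)
  have E1: "ceer ?E1" and E2: "ceer ?E2" and R: "ceer ?R"
    by (intro ceer_uniform_join ceer_post_ceer ceer_Id)+
  show dE1: "dark ?E1" by (intro dark_uniform_join dark_post_ceer)
  show "light ?E2" using E2 reducible_uniform_join_right by (simp add: light_def)
  show "\<not> ?E1 \<le>\<^sub>c ?E2" by (intro dark_join_not_reducible_join_Id dark_post_ceer)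
  show "\<not> ?E2 \<le>\<^sub>c ?E1"
    using dE1 reducible_uniform_join_right reducible_trans unfolding dark_def by blast
  show "ceer ?R" by fact
  have nE: "\<not> Id \<le>\<^sub>c ?E" "\<not> Id \<le>\<^sub>c ?E1"
    using dark_post_ceer dE1 by (simp_all add: dark_def)
  \<comment> \<open>\<open>?R\<close> bounds both \<open>?E\<close> and \<open>Id\<close>, and
    \<open>?E2\<close> is the least such bound.\<close>
  have "?E2 \<le>\<^sub>c ?R"
    by (intro join_Id_least E nE R reducible_uniform_join_right
        reducible_trans[OF reducible_uniform_join_left reducible_uniform_join_left])
  \<comment> \<open>A bound of \<open>?E1\<close> and \<open>?E2\<close> is above \<open>?E1\<close>
    and \<open>Id\<close>, hence above their join, as \<open>?E1\<close> is dark.\<close>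
  then show "degree_lub ?R ?E1 ?E2"
    unfolding degree_lub_iff[OF R E1 E2]
    using join_Id_least[OF E1 nE(2)] reducible_uniform_join_left reducible_uniform_join_right
      reducible_trans by blast
  \<comment> \<open>The irreducibility result again, now with the dark ceer \<open>?E1\<close> in
    the role of \<open>D\<close>.\<close>
  have "\<not> ?E1 \<oplus>\<^sub>c ?E \<le>\<^sub>c ?R"
    by (intro dark_join_not_reducible_join_Id dark_uniform_join dark_post_ceer)
  moreover have "?E1 \<oplus>\<^sub>c ?E \<le>\<^sub>c ?E1 \<oplus>\<^sub>c ?E2"
    by (intro uniform_join_mono_right reducible_uniform_join_left)
  moreover have "?R \<le>\<^sub>c ?E1 \<oplus>\<^sub>c ?E2"
    by (intro uniform_join_mono_right reducible_uniform_join_right)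
  ultimately show "?R <\<^sub>c ?E1 \<oplus>\<^sub>c ?E2"
    unfolding strictly_reducible_def using reducible_trans by blast
qed

end
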